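(* There are universal constants $c,C>0$ such that for every $n\ge1$ and every read-once formula $f:\{0,1\}^n\to\{0,1\}$ on $n$ variables, $c\sqrt n\le \widetilde{\deg}(f)\le C\sqrt n$.
   Context: A read-once formula is a Boolean formula over the De Morgan basis (AND, OR, NOT gates, arbitrary fan-in for AND/OR) in which each of the $n$ variables appears exactly once. A real polynomial $q$ $1/3$-approximates $f$ if $q(x)\in[0,1/3]$ for $x\in f^{-1}(0)$ and $q(x)\in[2/3,1]$ for $x\in f^{-1}(1)$; $\widetilde{\deg}(f)$ is the minimum degree of such a polynomial. *)

theory Defs
  imports Complex_Main
begin

datatype rformula = V nat | Neg rformula | AndG "rformula list" | OrG "rformula list"

fun evalf :: "(nat \<Rightarrow> bool) \<Rightarrow> rformula \<Rightarrow> bool" where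
  "evalf x (V i) = x i"
| "evalf x (Neg g) = (\<not> evalf x g)"
| "evalf x (AndG gs) = (\<forall>g\<in>set gs. evalf x g)"
| "evalf x (OrG gs) = (\<exists>g\<in>set gs. evalf x g)"

fun varlist :: "rformula \<Rightarrow> nat list" where
  "varlist (V i) = [i]"
| "varlist (Neg g) = varlist g"
| "varlist (AndG gs) = concat (map varlist gs)"
| "varlist (OrG gs) = concat (map varlist gs)"

fun gates_ok :: "rformula \<Rightarrow> bool" where
  "gates_ok (V i) = True"
| "gates_ok (Neg g) = gates_ok g"
| "gates_ok (AndG gs) = (gs \<noteq> [] \<and> (\<forall>g\<in>set gs. gates_ok g))"
| "gates_ok (OrG gs) = (gs \<noteq> [] \<and> (\<forall>g\<in>set gs. gates_ok g))"

definition read_once :: "nat \<Rightarrow> rformula \<Rightarrow> bool" where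
  "read_once n \<phi> \<longleftrightarrow> gates_ok \<phi> \<and> distinct (varlist \<phi>) \<and> set (varlist \<phi>) = {0..<n}"

text \<open>q is (the evaluation function of) a real polynomial in variables x_0..x_{n-1}
  of total degree at most d; monomials are exponent vectors m.\<close>
definition poly_deg_le :: "nat \<Rightarrow> nat \<Rightarrow> ((nat \<Rightarrow> real) \<Rightarrow> real) \<Rightarrow> bool" where
  "poly_deg_le n d q \<longleftrightarrow>
     (\<exists>M :: (nat \<Rightarrow> nat) set. \<exists>c :: (nat \<Rightarrow> nat) \<Rightarrow> real.
        finite M \<and> (\<forall>m\<in>M. (\<forall>i\<ge>n. m i = 0) \<and> (\<Sum>i<n. m i) \<le> d) \<and>
        (\<forall>x. q x = (\<Sum>m\<in>M. c m * (\<Prod>i<n. x i ^ m i))))"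

definition approximates :: "((nat \<Rightarrow> real) \<Rightarrow> real) \<Rightarrow> ((nat \<Rightarrow> bool) \<Rightarrow> bool) \<Rightarrow> bool" where
  "approximates q F \<longleftrightarrow>
     (\<forall>x. let v = q (\<lambda>i. of_bool (x i)) in
        (F x \<longrightarrow> 2/3 \<le> v \<and> v \<le> 1) \<and> (\<not> F x \<longrightarrow> 0 \<le> v \<and> v \<le> 1/3))"

definition approx_deg :: "nat \<Rightarrow> ((nat \<Rightarrow> bool) \<Rightarrow> bool) \<Rightarrow> nat" where
  "approx_deg n F = (LEAST d. \<exists>q. poly_deg_le n d q \<and> approximates q F)"

end

theory Submission
  imports Defs
begin

text \<open>Upper bound: the dual adversary program composes exactly along a read-once formula and has
  value at most \<open>sqrt n\<close>. A solution gives two reflections whose product \<open>U\<close> has a fixed vector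
  close to a unit vector \<open>e\<close> on ones, while on zeros \<open>e\<close> is a coboundary \<open>(\<psi> - U \<psi>) / 2\<close> with
  \<open>\<psi>\<close> of norm \<open>O (sqrt n)\<close>. The mean of \<open>\<langle>e, U\<^sup>k e\<rangle>\<close> over \<open>k < N\<close> is therefore near 1 on
  ones and at most \<open>norm \<psi> / N\<close> on zeros, and it is a polynomial of degree less than \<open>N\<close> in the
  input.

  Lower bound: the spectral norm of the sensitivity graph is at least \<open>sqrt n\<close>, again by exact
  composition, and it is \<open>O (d)\<close> for a function approximated in degree \<open>d\<close>, because the
  commutator of the adjacency operator of the cube with multiplication by a bounded polynomial of
  degree \<open>d\<close> has norm \<open>O (d)\<close>.\<close>

section \<open>Read-once functions\<close>

text \<open>Gates of arbitrary fan-in reduce to negation and binary conjunction on disjoint variable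
  sets, so both bounds are proved by induction with only three cases. No constant arises, and the
  variable set is never empty.\<close>

inductive read_once_fun :: "nat set \<Rightarrow> ((nat \<Rightarrow> bool) \<Rightarrow> bool) \<Rightarrow> bool" where
  var: "read_once_fun {i} (\<lambda>x. x i)"
| neg: "read_once_fun S F \<Longrightarrow> read_once_fun S (\<lambda>x. \<not> F x)"
| conj: "read_once_fun S F \<Longrightarrow> read_once_fun T G \<Longrightarrow> S \<inter> T = {} \<Longrightarrow>
    read_once_fun (S \<union> T) (\<lambda>x. F x \<and> G x)"

lemma read_once_fun_disj:
  assumes "read_once_fun S F" "read_once_fun T G" "S \<inter> T = {}"
  shows "read_once_fun (S \<union> T) (\<lambda>x. F x \<or> G x)"
proof -
  have "read_once_fun (S \<union> T) (\<lambda>x. \<not> (\<not> F x \<and> \<not> G x))"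
    by (intro read_once_fun.intros assms)
  then show ?thesis by simp
qed

lemma read_once_fun_evalf:
  assumes "gates_ok \<phi>" "distinct (varlist \<phi>)"
  shows "read_once_fun (set (varlist \<phi>)) (\<lambda>x. evalf x \<phi>)"
  using assms
proof (induction \<phi>)
  case (V i)
  then show ?case by (simp add: read_once_fun.var)
next
  case (Neg g)
  then show ?case by (simp add: read_once_fun.neg)
next
  case (AndG gs)
  have gates: "read_once_fun (set (varlist g)) (\<lambda>x. evalf x g)" if "g \<in> set gs" for g
    using AndG that by (auto simp: distinct_concat_iff)
  \<comment> \<open>The induction starts at one-element lists: the empty conjunction is constant and
    lies outside \<open>read_once_fun\<close>.\<close>
  have "read_once_fun (set (concat (map varlist gs))) (\<lambda>x. \<forall>g\<in>set gs. evalf x g)"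
    if "gs \<noteq> []" "distinct (concat (map varlist gs))"
      "\<And>g. g \<in> set gs \<Longrightarrow> read_once_fun (set (varlist g)) (\<lambda>x. evalf x g)" for gs
    using that
  proof (induction gs rule: list_nonempty_induct)
    case (single g)
    then show ?case by simp
  next
    case (cons g gs)
    have "read_once_fun (set (varlist g) \<union> set (concat (map varlist gs)))
        (\<lambda>x. evalf x g \<and> (\<forall>g\<in>set gs. evalf x g))"
      using cons by (intro read_once_fun.conj) auto
    then show ?case by simp
  qed
  then show ?case using AndG.prems gates by simp
next
  case (OrG gs)
  have gates: "read_once_fun (set (varlist g)) (\<lambda>x. evalf x g)" if "g \<in> set gs" for g
    using OrG that by (auto simp: distinct_concat_iff)
  have "read_once_fun (set (concat (map varlist gs))) (\<lambda>x. \<exists>g\<in>set gs. evalf x g)"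
    if "gs \<noteq> []" "distinct (concat (map varlist gs))"
      "\<And>g. g \<in> set gs \<Longrightarrow> read_once_fun (set (varlist g)) (\<lambda>x. evalf x g)" for gs
    using that
  proof (induction gs rule: list_nonempty_induct)
    case (single g)
    then show ?case by simp
  next
    case (cons g gs)
    have "read_once_fun (set (varlist g) \<union> set (concat (map varlist gs)))
        (\<lambda>x. evalf x g \<or> (\<exists>g\<in>set gs. evalf x g))"
      using cons by (intro read_once_fun_disj) auto
    then show ?case by simp
  qed
  then show ?case using OrG.prems gates by simp
qed

lemma read_once_fun_finite: "read_once_fun S F \<Longrightarrow> finite S \<and> S \<noteq> {}"
  by (induction rule: read_once_fun.induct) auto

lemma read_once_fun_cong:
  "read_once_fun S F \<Longrightarrow> (\<And>i. i \<in> S \<Longrightarrow> x i = y i) \<Longrightarrow> F x = F y"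
  by (induction rule: read_once_fun.induct) auto

section \<open>Polynomials of bounded degree\<close>

lemma poly_deg_le_mono: "poly_deg_le n d q \<Longrightarrow> d \<le> e \<Longrightarrow> poly_deg_le n e q"
  unfolding poly_deg_le_def by (meson le_trans)

lemma poly_deg_le_cong:
  assumes "poly_deg_le n d q" "\<And>i. i < n \<Longrightarrow> x i = y i"
  shows "q x = q y"
proof -
  obtain M c where "\<And>x. q x = (\<Sum>m\<in>M. c m * (\<Prod>i<n. x i ^ m i))"
    using assms(1) unfolding poly_deg_le_def by blast
  then show ?thesis using assms(2) by simp
qed

lemma poly_deg_le_const: "poly_deg_le n d (\<lambda>x. a)"
  unfolding poly_deg_le_def
  by (rule exI[of _ "{\<lambda>_. 0}"], rule exI[of _ "\<lambda>_. a"]) auto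

lemma poly_deg_le_cmult:
  assumes "poly_deg_le n d q"
  shows "poly_deg_le n d (\<lambda>x. a * q x)"
proof -
  obtain M c where M: "finite M" "\<forall>m\<in>M. (\<forall>i\<ge>n. m i = 0) \<and> (\<Sum>i<n. m i) \<le> d"
    "\<And>x. q x = (\<Sum>m\<in>M. c m * (\<Prod>i<n. x i ^ m i))"
    using assms unfolding poly_deg_le_def by blast
  show ?thesis unfolding poly_deg_le_def
    by (rule exI[of _ M], rule exI[of _ "\<lambda>m. a * c m"])
      (use M in \<open>simp add: sum_distrib_left mult.assoc\<close>)
qed

lemma poly_deg_le_add:
  assumes "poly_deg_le n d p" "poly_deg_le n d q"
  shows "poly_deg_le n d (\<lambda>x. p x + q x)"
proof -
  obtain M c where M: "finite M" "\<forall>m\<in>M. (\<forall>i\<ge>n. m i = 0) \<and> (\<Sum>i<n. m i) \<le> d"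
    "\<And>x. p x = (\<Sum>m\<in>M. c m * (\<Prod>i<n. x i ^ m i))"
    using assms(1) unfolding poly_deg_le_def by blast
  obtain L e where L: "finite L" "\<forall>m\<in>L. (\<forall>i\<ge>n. m i = 0) \<and> (\<Sum>i<n. m i) \<le> d"
    "\<And>x. q x = (\<Sum>m\<in>L. e m * (\<Prod>i<n. x i ^ m i))"
    using assms(2) unfolding poly_deg_le_def by blast
  have p: "p x = (\<Sum>m\<in>M \<union> L. (if m \<in> M then c m else 0) * (\<Prod>i<n. x i ^ m i))" for x
    unfolding M(3) by (rule sum.mono_neutral_cong_left) (use M L in auto)
  have q: "q x = (\<Sum>m\<in>M \<union> L. (if m \<in> L then e m else 0) * (\<Prod>i<n. x i ^ m i))" for x
    unfolding L(3) by (rule sum.mono_neutral_cong_left) (use M L in auto)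
  show ?thesis unfolding poly_deg_le_def
    by (rule exI[of _ "M \<union> L"],
        rule exI[of _ "\<lambda>m. (if m \<in> M then c m else 0) + (if m \<in> L then e m else 0)"])
      (use M(1,2) L(1,2) in \<open>auto simp: p q sum.distrib[symmetric] distrib_right\<close>)
qed

lemma poly_deg_le_sum:
  "(\<And>i. i \<in> A \<Longrightarrow> poly_deg_le n d (q i)) \<Longrightarrow> poly_deg_le n d (\<lambda>x. \<Sum>i\<in>A. q i x)"
  by (induction A rule: infinite_finite_induct) (simp_all add: poly_deg_le_const poly_deg_le_add)

lemma poly_deg_le_times_var:
  assumes "poly_deg_le n d q" "j < n"
  shows "poly_deg_le n (Suc d) (\<lambda>x. x j * q x)"
proof -
  obtain M c where M: "finite M" "\<forall>m\<in>M. (\<forall>i\<ge>n. m i = 0) \<and> (\<Sum>i<n. m i) \<le> d"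
    "\<And>x. q x = (\<Sum>m\<in>M. c m * (\<Prod>i<n. x i ^ m i))"
    using assms unfolding poly_deg_le_def by blast
  \<comment> \<open>Multiplication by \<open>x j\<close> shifts exponent vectors along
    \<open>up\<close>; its left inverse \<open>dn\<close> carries the coefficients over to the
    shifted vectors.\<close>
  define up :: "(nat \<Rightarrow> nat) \<Rightarrow> nat \<Rightarrow> nat" where "up m = m(j := Suc (m j))" for m
  define dn :: "(nat \<Rightarrow> nat) \<Rightarrow> nat \<Rightarrow> nat" where "dn m = m(j := m j - 1)" for m
  have dn: "dn (up m) = m" for m by (auto simp: up_def dn_def)
  then have inj: "inj_on up M" by (metis inj_onI)
  have deg: "(\<Sum>i<n. up m i) = Suc (\<Sum>i<n. m i)" for m
  proof -
    have "up m i = m i + (if i = j then 1 else 0)" for i by (simp add: up_def)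
    then show ?thesis using assms(2) by (simp add: sum.distrib)
  qed
  have prod: "(\<Prod>i<n. x i ^ up m i) = x j * (\<Prod>i<n. x i ^ m i)" for x :: "nat \<Rightarrow> real" and m
  proof -
    have "x i ^ up m i = (if i = j then x j else 1) * x i ^ m i" for i by (simp add: up_def)
    then show ?thesis using assms(2) by (simp add: prod.distrib)
  qed
  have "x j * q x = (\<Sum>m\<in>up ` M. c (dn m) * (\<Prod>i<n. x i ^ m i))" for x
    by (simp add: sum.reindex[OF inj] dn prod M(3) sum_distrib_left mult_ac)
  moreover have "\<forall>m\<in>up ` M. (\<forall>i\<ge>n. m i = 0) \<and> (\<Sum>i<n. m i) \<le> Suc d"
    using M(2) assms(2) by (auto simp: deg) (simp add: up_def)
  ultimately show ?thesis unfolding poly_deg_le_def using M(1)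
    by (intro exI[of _ "up ` M"] exI[of _ "\<lambda>m. c (dn m)"]) auto
qed

section \<open>Upper bound\<close>

text \<open>A solution of the dual adversary program with one-dimensional vectors. At a gate the
  solutions of the two inputs are rescaled so that the products of the sizes on ones and on zeros
  (the numbers of variables) add up.\<close>

lemma read_once_fun_dual_adversary:
  assumes "read_once_fun S F"
  shows "\<exists>w :: (nat \<Rightarrow> bool) \<Rightarrow> nat \<Rightarrow> real.
    (\<forall>x y. F x \<longrightarrow> \<not> F y \<longrightarrow> (\<Sum>j\<in>S. of_bool (x j \<noteq> y j) * (w x j * w y j)) = 1) \<and>
    (\<forall>x. (\<Sum>j\<in>S. (w x j)\<^sup>2) \<le> sqrt (card S))"
  using assms
proof (induction rule: read_once_fun.induct)
  case (var i)
  then show ?case by (intro exI[of _ "\<lambda>_ _. 1"]) simp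
next
  case (neg S F)
  then obtain w where w:
    "\<And>x y. F x \<Longrightarrow> \<not> F y \<Longrightarrow> (\<Sum>j\<in>S. of_bool (x j \<noteq> y j) * (w x j * w y j)) = (1::real)"
    "\<And>x. (\<Sum>j\<in>S. (w x j)\<^sup>2) \<le> sqrt (card S)" by blast
  have "(\<Sum>j\<in>S. of_bool (x j \<noteq> y j) * (w x j * w y j)) = 1" if "\<not> F x" "F y" for x y
  proof -
    have "(\<Sum>j\<in>S. of_bool (x j \<noteq> y j) * (w x j * w y j)) =
        (\<Sum>j\<in>S. of_bool (y j \<noteq> x j) * (w y j * w x j))"
      by (intro sum.cong) auto
    then show ?thesis using w(1)[OF that(2,1)] by simp
  qed
  with w(2) show ?case by (intro exI[of _ w]) auto
next
  case (conj S F T G)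
  then obtain v w where v:
    "\<And>x y. F x \<Longrightarrow> \<not> F y \<Longrightarrow> (\<Sum>j\<in>S. of_bool (x j \<noteq> y j) * (v x j * v y j)) = (1::real)"
    "\<And>x. (\<Sum>j\<in>S. (v x j)\<^sup>2) \<le> sqrt (card S)"
    and w: "\<And>x y. G x \<Longrightarrow> \<not> G y \<Longrightarrow> (\<Sum>j\<in>T. of_bool (x j \<noteq> y j) * (w x j * w y j)) = (1::real)"
    "\<And>x. (\<Sum>j\<in>T. (w x j)\<^sup>2) \<le> sqrt (card T)" by blast
  note fin = read_once_fun_finite[OF conj.hyps(1)] read_once_fun_finite[OF conj.hyps(2)]
  define a b n where "a = real (card S)" and "b = real (card T)" and "n = real (card (S \<union> T))"
  have pos: "a > 0" "b > 0" using fin by (auto simp: a_def b_def card_gt_0_iff)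
  have n: "n = a + b" using fin conj.hyps(3) by (simp add: a_def b_def n_def card_Un_disjoint)
  \<comment> \<open>The fourth roots are forced: zeros have size
    \<open>sqrt a / \<alpha>\<^sup>2\<close> or \<open>sqrt b / \<beta>\<^sup>2\<close>, and both
    must equal \<open>sqrt n\<close>. On ones the sizes then add up to
    \<open>(a + b) / sqrt n\<close>, which is again \<open>sqrt n\<close>.\<close>
  define \<alpha> \<beta> where "\<alpha> = sqrt (sqrt (a / n))" and "\<beta> = sqrt (sqrt (b / n))"
  have ab: "\<alpha> > 0" "\<beta> > 0" "\<alpha>\<^sup>2 = sqrt a / sqrt n" "\<beta>\<^sup>2 = sqrt b / sqrt n"
    using pos n by (auto simp: \<alpha>_def \<beta>_def real_sqrt_divide power_divide)
  \<comment> \<open>On a zero of the conjunction only one false conjunct carries weight, namely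
    \<open>F\<close> if it is false and \<open>G\<close> otherwise. Against a one, the scale factors
    cancel and exactly one of the two constraints survives.\<close>
  define z where "z x j = (if F x \<and> G x then (if j \<in> S then \<alpha> * v x j else \<beta> * w x j)
     else if \<not> F x then (if j \<in> S then v x j / \<alpha> else 0)
     else (if j \<in> S then 0 else w x j / \<beta>))" for x j
  have split: "(\<Sum>j\<in>S \<union> T. h j) = (\<Sum>j\<in>S. h j) + (\<Sum>j\<in>T. h j)" for h :: "nat \<Rightarrow> real"
    using fin conj.hyps(3) by (simp add: sum.union_disjoint)
  have notS: "j \<notin> S" if "j \<in> T" for j using that conj.hyps(3) by auto
  have "(\<Sum>j\<in>S \<union> T. of_bool (x j \<noteq> y j) * (z x j * z y j)) = 1"
    if x: "F x \<and> G x" and y: "\<not> (F y \<and> G y)" for x y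
  proof (cases "F y")
    case False
    have "(\<Sum>j\<in>S \<union> T. of_bool (x j \<noteq> y j) * (z x j * z y j)) =
        (\<Sum>j\<in>S. of_bool (x j \<noteq> y j) * (v x j * v y j))"
      unfolding split using False x y ab(1,2) notS by (simp add: z_def)
    then show ?thesis using v(1) x False by simp
  next
    case True
    have "(\<Sum>j\<in>S \<union> T. of_bool (x j \<noteq> y j) * (z x j * z y j)) =
        (\<Sum>j\<in>T. of_bool (x j \<noteq> y j) * (w x j * w y j))"
      unfolding split using True x y ab(1,2) notS by (simp add: z_def)
    then show ?thesis using w(1) x y True by simp
  qed
  moreover have "(\<Sum>j\<in>S \<union> T. (z x j)\<^sup>2) \<le> sqrt n" for x
  proof -
    consider "F x \<and> G x" | "\<not> F x" | "F x" "\<not> G x" by blast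
    then show ?thesis
    proof cases
      case 1
      then have "(\<Sum>j\<in>S \<union> T. (z x j)\<^sup>2) = \<alpha>\<^sup>2 * (\<Sum>j\<in>S. (v x j)\<^sup>2) + \<beta>\<^sup>2 * (\<Sum>j\<in>T. (w x j)\<^sup>2)"
        unfolding split using notS by (simp add: z_def power_mult_distrib sum_distrib_left)
      also have "\<dots> \<le> \<alpha>\<^sup>2 * sqrt a + \<beta>\<^sup>2 * sqrt b"
        unfolding a_def b_def by (intro add_mono mult_left_mono v(2) w(2)) auto
      also have "\<dots> = (a + b) / sqrt n"
        using pos by (simp add: ab add_divide_distrib)
      also have "\<dots> = sqrt n" using pos n by (simp add: real_div_sqrt)
      finally show ?thesis .
    next
      case 2
      then have "(\<Sum>j\<in>S \<union> T. (z x j)\<^sup>2) = (\<Sum>j\<in>S. (v x j)\<^sup>2) / \<alpha>\<^sup>2"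
        unfolding split using notS by (simp add: z_def power_divide sum_divide_distrib)
      also have "\<dots> \<le> sqrt a / \<alpha>\<^sup>2"
        unfolding a_def by (intro divide_right_mono v(2)) auto
      also have "\<dots> = sqrt n" using pos by (simp add: ab)
      finally show ?thesis .
    next
      case 3
      then have "(\<Sum>j\<in>S \<union> T. (z x j)\<^sup>2) = (\<Sum>j\<in>T. (w x j)\<^sup>2) / \<beta>\<^sup>2"
        unfolding split using notS by (simp add: z_def power_divide sum_divide_distrib)
      also have "\<dots> \<le> sqrt b / \<beta>\<^sup>2"
        unfolding b_def by (intro divide_right_mono w(2)) auto
      also have "\<dots> = sqrt n" using pos by (simp add: ab)
      finally show ?thesis .
    qed
  qed
  ultimately show ?case unfolding n_def by blast
qed

section \<open>Reflections given by explicit real matrices\<close>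

text \<open>Vectors are total functions of which only the entries in \<open>I\<close> matter. With
  explicit matrices, the entries of an iterated product are visibly polynomials in the
  input.\<close>

definition mat_app :: "'i set \<Rightarrow> ('i \<Rightarrow> 'i \<Rightarrow> real) \<Rightarrow> ('i \<Rightarrow> real) \<Rightarrow> 'i \<Rightarrow> real" where
  "mat_app I M v i = (\<Sum>k\<in>I. M i k * v k)"

lemma mat_app_cong: "(\<And>k. k \<in> I \<Longrightarrow> u k = v k) \<Longrightarrow> mat_app I M u = mat_app I M v"
  by (simp add: mat_app_def fun_eq_iff)

lemma mat_app_linear:
  "mat_app I M (\<lambda>k. a * u k + b * v k) i = a * mat_app I M u i + b * mat_app I M v i"
  by (simp add: mat_app_def sum.distrib sum_distrib_left algebra_simps)

lemma mat_app_symmetric: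
  assumes "\<And>i k. M i k = M k i"
  shows "(\<Sum>i\<in>I. mat_app I M u i * v i) = (\<Sum>i\<in>I. u i * mat_app I M v i)"
proof -
  have "(\<Sum>i\<in>I. mat_app I M u i * v i) = (\<Sum>i\<in>I. \<Sum>k\<in>I. M i k * u k * v i)"
    by (simp add: mat_app_def sum_distrib_right)
  also have "\<dots> = (\<Sum>k\<in>I. \<Sum>i\<in>I. M i k * u k * v i)" by (rule sum.swap)
  also have "\<dots> = (\<Sum>i\<in>I. u i * mat_app I M v i)"
    using assms by (auto simp: mat_app_def sum_distrib_left mult_ac intro!: sum.cong)
  finally show ?thesis .
qed

text \<open>The matrix is the identity minus twice the orthogonal projection onto the span of
  \<open>P\<close>. It is built one vector at a time, as in Gram-Schmidt, each new direction
  contributing a Householder reflection.\<close>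

lemma reflection_exists:
  fixes P :: "('i \<Rightarrow> real) set"
  assumes "finite P" "finite I"
  shows "\<exists>M. (\<forall>i k. M i k = M k i) \<and>
    (\<forall>v. \<forall>i\<in>I. mat_app I M (mat_app I M v) i = v i) \<and>
    (\<forall>p\<in>P. \<forall>i\<in>I. mat_app I M p i = - p i) \<and>
    (\<forall>v. (\<forall>p\<in>P. (\<Sum>i\<in>I. p i * v i) = 0) \<longrightarrow> (\<forall>i\<in>I. mat_app I M v i = v i))"
  using assms(1)
proof (induction P rule: finite_induct)
  case empty
  have "mat_app I (\<lambda>i k. of_bool (i = k)) v i = v i" if "i \<in> I" for i and v :: "'i \<Rightarrow> real"
  proof -
    have "mat_app I (\<lambda>i k. of_bool (i = k)) v i = (\<Sum>k\<in>I. if i = k then v k else 0)"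
      by (auto simp: mat_app_def intro!: sum.cong)
    then show ?thesis using assms(2) that by simp
  qed
  then show ?case
    by (intro exI[of _ "\<lambda>i k. of_bool (i = k)"]) auto
next
  case (insert p P)
  then obtain M where M: "\<forall>i k. M i k = M k i"
    "\<forall>v. \<forall>i\<in>I. mat_app I M (mat_app I M v) i = v i"
    "\<forall>p\<in>P. \<forall>i\<in>I. mat_app I M p i = - p i"
    "\<forall>v. (\<forall>p\<in>P. (\<Sum>i\<in>I. p i * v i) = 0) \<longrightarrow> (\<forall>i\<in>I. mat_app I M v i = v i)"
    by blast
  have sym: "M i k = M k i" for i k using M(1) by blast
  have inv: "mat_app I M (mat_app I M v) i = v i" if "i \<in> I" for v i using M(2) that by blast
  have neg: "mat_app I M p i = - p i" if "p \<in> P" "i \<in> I" for p i using M(3) that by blast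
  have stay: "mat_app I M v i = v i"
    if "\<And>p. p \<in> P \<Longrightarrow> (\<Sum>i\<in>I. p i * v i) = 0" "i \<in> I" for v i using M(4) that by blast
  \<comment> \<open>\<open>M\<close> acts as -1 on the span of \<open>P\<close> and as 1 on its
    complement, so \<open>r\<close> is the component of \<open>p\<close> orthogonal to that
    span.\<close>
  define r where "r i = (p i + mat_app I M p i) / 2" for i
  have r': "r = (\<lambda>i. (1/2) * p i + (1/2) * mat_app I M p i)"
    by (simp add: r_def fun_eq_iff field_simps)
  have Mr: "mat_app I M r i = r i" if "i \<in> I" for i
    unfolding r' mat_app_linear using that inv by simp
  define t where "t = (\<Sum>i\<in>I. r i * r i)"
  have symip: "(\<Sum>i\<in>I. mat_app I M u i * v i) = (\<Sum>i\<in>I. u i * mat_app I M v i)" for u v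
    by (rule mat_app_symmetric) (rule sym)
  have rp: "(\<Sum>i\<in>I. r i * p i) = t"
  proof -
    have "(\<Sum>i\<in>I. r i * mat_app I M p i) = (\<Sum>i\<in>I. r i * p i)"
      using Mr by (simp add: symip[symmetric])
    moreover have "t = (1/2) * (\<Sum>i\<in>I. r i * p i) + (1/2) * (\<Sum>i\<in>I. r i * mat_app I M p i)"
      unfolding t_def sum_distrib_left sum.distrib[symmetric]
      by (intro sum.cong) (auto simp: r_def field_simps)
    ultimately show ?thesis by simp
  qed
  have rP: "(\<Sum>i\<in>I. r i * q i) = 0" if "q \<in> P" for q
  proof -
    have "(\<Sum>i\<in>I. r i * q i) = (\<Sum>i\<in>I. r i * mat_app I M q i)"
      using Mr by (simp add: symip[symmetric])
    then show ?thesis using neg[OF that] by (simp add: sum_negf)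
  qed
  show ?case
  proof (cases "t = 0")
    \<comment> \<open>Here \<open>p\<close> already lies in the span of \<open>P\<close>, and
      \<open>M\<close> needs no change.\<close>
    case True
    then have "r i = 0" if "i \<in> I" for i
      using that assms(2) by (auto simp: t_def sum_nonneg_eq_0_iff)
    then have "mat_app I M p i = - p i" if "i \<in> I" for i
      using that by (fastforce simp: r_def)
    then show ?thesis
      using sym inv neg stay by (intro exI[of _ M]) auto
  next
    case False
    \<comment> \<open>\<open>L\<close> is \<open>M\<close> composed with the Householder reflection
      along \<open>r\<close>; the product takes this short form because \<open>M\<close> fixes
      \<open>r\<close>.\<close>
    define L where "L i k = M i k - 2 * r i * r k / t" for i k
    have L: "mat_app I L v i = mat_app I M v i - 2 * (\<Sum>k\<in>I. r k * v k) / t * r i" for v i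
      by (simp add: mat_app_def L_def algebra_simps sum_subtractf sum_distrib_left sum_divide_distrib)
    have L': "mat_app I L v = (\<lambda>i. 1 * mat_app I M v i + (- 2 * (\<Sum>k\<in>I. r k * v k) / t) * r i)" for v
      by (simp add: L fun_eq_iff)
    have "mat_app I L (mat_app I L v) i = v i" if i: "i \<in> I" for v i
    proof -
      let ?c = "\<Sum>k\<in>I. r k * v k"
      have "(\<Sum>k\<in>I. r k * mat_app I L v k) = (\<Sum>k\<in>I. r k * mat_app I M v k) - 2 * ?c / t * t"
        unfolding L t_def sum_distrib_left sum_subtractf[symmetric]
        by (intro sum.cong) (auto simp: algebra_simps)
      also have "(\<Sum>k\<in>I. r k * mat_app I M v k) = ?c"
        using Mr by (simp add: symip[symmetric])
      finally have c: "(\<Sum>k\<in>I. r k * mat_app I L v k) = - ?c" using False by simp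
      have "mat_app I M (mat_app I L v) i = v i - 2 * ?c / t * r i"
        unfolding L' mat_app_linear using i inv Mr by simp
      then show ?thesis unfolding L[of "mat_app I L v"] c by simp
    qed
    moreover have "mat_app I L q i = - q i" if "q \<in> insert p P" "i \<in> I" for q i
    proof (cases "q \<in> P")
      case True
      then show ?thesis using that rP neg by (simp add: L)
    next
      case q: False
      then have "q = p" using that by simp
      moreover have "mat_app I L p i = mat_app I M p i - 2 * r i" using False rp by (simp add: L)
      ultimately show ?thesis by (simp add: r_def field_simps)
    qed
    moreover have "mat_app I L v i = v i"
      if v: "\<forall>q\<in>insert p P. (\<Sum>i\<in>I. q i * v i) = 0" and i: "i \<in> I" for v i
    proof -
      have Mv: "mat_app I M v i = v i" if "i \<in> I" for i
        using v that by (intro stay) auto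
      have "(\<Sum>i\<in>I. mat_app I M p i * v i) = (\<Sum>i\<in>I. p i * v i)"
        using Mv by (simp add: symip)
      moreover have "(\<Sum>i\<in>I. r i * v i) =
          (1/2) * (\<Sum>i\<in>I. p i * v i) + (1/2) * (\<Sum>i\<in>I. mat_app I M p i * v i)"
        unfolding sum_distrib_left sum.distrib[symmetric]
        by (intro sum.cong) (auto simp: r_def field_simps)
      ultimately have "(\<Sum>i\<in>I. r i * v i) = 0" using v by simp
      then show ?thesis using Mv[OF i] by (simp add: L)
    qed
    moreover have "L i k = L k i" for i k by (simp add: L_def sym[of i k] mult_ac)
    ultimately show ?thesis by (intro exI[of _ L] conjI allI ballI impI) blast+
  qed
qed

text \<open>Inputs are functions on all of \<open>nat\<close>. Representatives that vanish from
  \<open>n\<close> on form a finite set, so that only finitely many vectors enter the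
  reflection.\<close>

lemma finite_cube: "finite {x :: nat \<Rightarrow> bool. \<forall>i\<ge>n. \<not> x i}"
proof -
  have "{x :: nat \<Rightarrow> bool. \<forall>i\<ge>n. \<not> x i} \<subseteq> (\<lambda>A i. i \<in> A) ` Pow {..<n}"
  proof
    fix x :: "nat \<Rightarrow> bool"
    assume "x \<in> {x. \<forall>i\<ge>n. \<not> x i}"
    then have "{i. x i} \<in> Pow {..<n}" by (auto simp: not_le[symmetric])
    then show "x \<in> (\<lambda>A i. i \<in> A) ` Pow {..<n}" by (intro image_eqI[of _ _ "{i. x i}"]) auto
  qed
  then show ?thesis by (rule finite_subset) simp
qed

text \<open>The polynomial is the mean of the first \<open>N\<close> return amplitudes of a product \<open>U\<close> of two
  reflections, one fixed and one linear in the input, started at the basis vector \<open>None\<close>.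
  On ones this vector is within 1/6 of a fixed vector of \<open>U\<close>; on zeros it equals
  \<open>(\<psi> - U \<psi>) / 2\<close>, so the mean telescopes.\<close>

lemma dual_adversary_imp_approx:
  fixes w :: "(nat \<Rightarrow> bool) \<Rightarrow> nat \<Rightarrow> real" and W :: real
  assumes dep: "\<And>x y. (\<And>i. i < n \<Longrightarrow> x i = y i) \<Longrightarrow> F x = F y"
    and adv: "\<And>x y. F x \<Longrightarrow> \<not> F y \<Longrightarrow> (\<Sum>j<n. of_bool (x j \<noteq> y j) * (w x j * w y j)) = 1"
    and size: "\<And>x. (\<Sum>j<n. (w x j)\<^sup>2) \<le> W"
    and W: "1 \<le> W" and N: "37 * W \<le> real N"
  shows "\<exists>q. poly_deg_le n N q \<and> approximates q F"
proof -
  \<comment> \<open>\<open>None\<close> indexes the start vector; \<open>Some (j, b)\<close> stands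
    for variable \<open>j\<close> having value \<open>b\<close>.\<close>
  define I :: "(nat \<times> bool) option set" where "I = insert None (Some ` ({..<n} \<times> UNIV))"
  have finI: "finite I" by (simp add: I_def)
  have None: "None \<in> I" by (simp add: I_def)
  have casesI: "i = None \<or> (\<exists>j b. i = Some (j, b) \<and> j < n)" if "i \<in> I" for i
    using that by (auto simp: I_def)
  have sumI: "(\<Sum>i\<in>I. h i) = h None + (\<Sum>j<n. h (Some (j, True)) + h (Some (j, False)))"
    for h :: "_ \<Rightarrow> real"
  proof -
    have "(\<Sum>i\<in>I. h i) = h None + (\<Sum>p\<in>{..<n} \<times> UNIV. h (Some p))"
      by (simp add: I_def sum.reindex)
    also have "(\<Sum>p\<in>{..<n} \<times> UNIV. h (Some p)) = (\<Sum>j<n. \<Sum>b\<in>UNIV. h (Some (j, b)))"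
      by (simp add: sum.cartesian_product)
    finally show ?thesis by (simp add: UNIV_bool add.commute)
  qed
  \<comment> \<open>This makes \<open>\<delta>\<^sup>2 * W\<close> equal to 1/36, giving the
    distance 1/6 on ones. On zeros the squared norm of \<open>\<psi>\<close> is at most
    \<open>1 + 36 * W\<^sup>2\<close>, hence at most \<open>(37 * W / 6)\<^sup>2\<close>, which
    explains the 37 in the bound on \<open>N\<close>.\<close>
  define \<delta> where "\<delta> = 1 / (6 * sqrt W)"
  have \<delta>: "\<delta> > 0" "\<delta>\<^sup>2 = 1 / (36 * W)"
    using W by (auto simp: \<delta>_def power_divide power_mult_distrib)
  define e0 :: "(nat \<times> bool) option \<Rightarrow> real" where "e0 i = of_bool (i = None)" for i
  \<comment> \<open>Apart from \<open>None\<close>, \<open>\<phi> x\<close> lives on the literals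
    true at \<open>x\<close> and \<open>\<psi> y\<close> on those false at \<open>y\<close>. They
    meet exactly where \<open>x\<close> and \<open>y\<close> differ, so the adversary constraint
    makes them orthogonal.\<close>
  define \<phi> where "\<phi> x i = (case i of None \<Rightarrow> 1 | Some (j, b) \<Rightarrow> \<delta> * w x j * of_bool (b = x j))" for x i
  define \<psi> where "\<psi> x i = (case i of None \<Rightarrow> 1 | Some (j, b) \<Rightarrow> - (w x j * of_bool (b \<noteq> x j) / \<delta>))" for x i
  define Q where "Q = {x :: nat \<Rightarrow> bool. \<forall>i\<ge>n. \<not> x i}"
  have orth: "(\<Sum>i\<in>I. \<psi> y i * \<phi> x i) = 0" if "F x" "\<not> F y" for x y
  proof -
    have "(\<Sum>i\<in>I. \<psi> y i * \<phi> x i) = 1 - (\<Sum>j<n. of_bool (x j \<noteq> y j) * (w x j * w y j))"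
      unfolding sumI sum_negf[symmetric] diff_conv_add_uminus
      using \<delta>(1) by (auto simp: \<phi>_def \<psi>_def intro!: sum.cong)
    then show ?thesis using adv[OF that] by simp
  qed
  have "finite (\<psi> ` {y \<in> Q. \<not> F y})" using finite_cube by (simp add: Q_def)
  \<comment> \<open>One input-independent \<open>M\<close> negates \<open>\<psi> y\<close> for all
    zeros \<open>y\<close> and, by orthogonality, fixes \<open>\<phi> x\<close> for all ones
    \<open>x\<close>.\<close>
  from reflection_exists[OF this finI] obtain M where
    sym: "\<forall>i k. M i k = M k i" and inv: "\<forall>v. \<forall>i\<in>I. mat_app I M (mat_app I M v) i = v i"
    and neg: "\<forall>p\<in>\<psi> ` {y \<in> Q. \<not> F y}. \<forall>i\<in>I. mat_app I M p i = - p i"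
    and stay: "\<forall>v. (\<forall>p\<in>\<psi> ` {y \<in> Q. \<not> F y}. (\<Sum>i\<in>I. p i * v i) = 0) \<longrightarrow> (\<forall>i\<in>I. mat_app I M v i = v i)"
    by blast
  \<comment> \<open>The input-dependent reflection: at a Boolean point the sign is 1 if
    \<open>b\<close> is the value of \<open>x j\<close> and -1 otherwise. It is affine in
    \<open>x j\<close>, so each application of \<open>U\<close> raises the degree by at most
    one.\<close>
  define sg :: "(nat \<Rightarrow> real) \<Rightarrow> (nat \<times> bool) option \<Rightarrow> real" where
    "sg x i = (case i of None \<Rightarrow> 1 | Some (j, b) \<Rightarrow> if b then 2 * x j - 1 else 1 - 2 * x j)" for x i
  define U where "U x v i = sg x i * mat_app I M v i" for x v i
  define q where "q x = (\<Sum>k<N. (U x ^^ k) e0 None) / N" for x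

  have "poly_deg_le n k (\<lambda>x. (U x ^^ k) e0 i)" if "i \<in> I" for k i
    using that
  proof (induction k arbitrary: i)
    case 0
    then show ?case by (simp add: poly_deg_le_const)
  next
    case (Suc k)
    have app: "poly_deg_le n k (\<lambda>x. mat_app I M ((U x ^^ k) e0) i)" for i
      unfolding mat_app_def by (intro poly_deg_le_sum poly_deg_le_cmult Suc.IH)
    have step: "(U x ^^ Suc k) e0 i = sg x i * mat_app I M ((U x ^^ k) e0) i" for x
      unfolding funpow.simps o_apply by (rule U_def)
    show ?case
    proof (cases i)
      case None
      then show ?thesis unfolding step using poly_deg_le_mono[OF app, of "Suc k"] by (simp add: sg_def)
    next
      case (Some p)
      then obtain j b where i: "i = Some (j, b)" "j < n" using Suc.prems casesI by blast
      define s :: real where "s = (if b then 1 else - 1)"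
      have "poly_deg_le n (Suc k) (\<lambda>x. (2 * s) * (x j * mat_app I M ((U x ^^ k) e0) i) +
          (- s) * mat_app I M ((U x ^^ k) e0) i)"
        by (intro poly_deg_le_add poly_deg_le_cmult poly_deg_le_times_var app i(2)
            poly_deg_le_mono[OF app]) simp
      moreover have "(2 * s) * (x j * mat_app I M ((U x ^^ k) e0) i) +
          (- s) * mat_app I M ((U x ^^ k) e0) i = (U x ^^ Suc k) e0 i" for x
        unfolding step by (simp add: sg_def i(1) s_def algebra_simps)
      ultimately show ?thesis by simp
    qed
  qed
  then have "poly_deg_le n N (\<lambda>x. (1 / N) * (\<Sum>k<N. (U x ^^ k) e0 None))"
    using None by (intro poly_deg_le_cmult poly_deg_le_sum) (meson lessThan_iff less_imp_le poly_deg_le_mono)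
  then have polyq: "poly_deg_le n N q" by (simp add: q_def[abs_def])

  have U_linear: "U x (\<lambda>i. a * u i + b * v i) = (\<lambda>i. a * U x u i + b * U x v i)" for x a b u v
    by (simp add: U_def mat_app_linear algebra_simps fun_eq_iff)
  have Uk_linear: "(U x ^^ k) (\<lambda>i. a * u i + b * v i) = (\<lambda>i. a * (U x ^^ k) u i + b * (U x ^^ k) v i)"
    for x k a b u v
    by (induction k) (simp_all add: U_linear)
  have U_cong: "U x u = U x v" if "\<And>i. i \<in> I \<Longrightarrow> u i = v i" for x u v
    using mat_app_cong[of I u v] that by (simp add: U_def fun_eq_iff)
  have Uk_cong: "(U x ^^ k) u i = (U x ^^ k) v i" if "\<And>i. i \<in> I \<Longrightarrow> u i = v i" "i \<in> I" for x k u v i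
    using that U_cong[of u v x] by (cases k) (simp_all add: funpow_Suc_right del: funpow.simps)

  \<comment> \<open>At Boolean points the signs are 1 or -1, and a symmetric involution is
    orthogonal.\<close>
  have U_norm: "(\<Sum>i\<in>I. (U (\<lambda>i. of_bool (x i)) v i)\<^sup>2) = (\<Sum>i\<in>I. (v i)\<^sup>2)" for x v
  proof -
    have "(sg (\<lambda>i. of_bool (x i)) i)\<^sup>2 = 1" for i by (auto simp: sg_def split: option.split)
    then have "(\<Sum>i\<in>I. (U (\<lambda>i. of_bool (x i)) v i)\<^sup>2) = (\<Sum>i\<in>I. mat_app I M v i * mat_app I M v i)"
      by (simp add: U_def power_mult_distrib) (simp add: power2_eq_square)
    also have "\<dots> = (\<Sum>i\<in>I. v i * mat_app I M (mat_app I M v) i)"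
      by (rule mat_app_symmetric) (use sym in blast)
    finally show ?thesis using inv by (simp add: power2_eq_square)
  qed
  have Uk_bound: "((U (\<lambda>i. of_bool (x i)) ^^ k) v None)\<^sup>2 \<le> (\<Sum>i\<in>I. (v i)\<^sup>2)" for x k v
  proof -
    have "(\<Sum>i\<in>I. ((U (\<lambda>i. of_bool (x i)) ^^ k) v i)\<^sup>2) = (\<Sum>i\<in>I. (v i)\<^sup>2)"
      by (induction k) (simp_all add: U_norm)
    moreover have "((U (\<lambda>i. of_bool (x i)) ^^ k) v None)\<^sup>2 \<le> (\<Sum>i\<in>I. ((U (\<lambda>i. of_bool (x i)) ^^ k) v i)\<^sup>2)"
      by (rule member_le_sum) (use None finI in auto)
    ultimately show ?thesis by simp
  qed

  have Npos: "real N > 0" using W N by linarith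
  have one: "\<bar>q (\<lambda>i. of_bool (x i)) - 1\<bar> \<le> 1 / 6" if x: "x \<in> Q" "F x" for x
  proof -
    let ?U = "U (\<lambda>i. of_bool (x i))"
    have "U (\<lambda>i. of_bool (x i)) (\<phi> x) i = \<phi> x i" if "i \<in> I" for i
    proof -
      have "mat_app I M (\<phi> x) i = \<phi> x i" using stay orth x that by auto
      then show ?thesis by (auto simp: U_def sg_def \<phi>_def split: option.split)
    qed
    then have fixd: "(?U ^^ k) (\<phi> x) i = \<phi> x i" if "i \<in> I" for k i
      using that
    proof (induction k arbitrary: i)
      case (Suc k)
      then show ?case using U_cong[of "(?U ^^ k) (\<phi> x)" "\<phi> x"] by simp
    qed simp
    define z where "z i = \<phi> x i - e0 i" for i
    have "(\<Sum>i\<in>I. (z i)\<^sup>2) = (\<Sum>j<n. \<delta>\<^sup>2 * (w x j)\<^sup>2)"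
      unfolding sumI by (auto simp: z_def \<phi>_def e0_def power_mult_distrib intro!: sum.cong)
    also have "\<dots> \<le> \<delta>\<^sup>2 * W"
      unfolding sum_distrib_left[symmetric] by (intro mult_left_mono size) simp
    also have "\<dots> = (1 / 6)\<^sup>2" using W by (simp add: \<delta>(2) power_divide)
    finally have z: "(\<Sum>i\<in>I. (z i)\<^sup>2) \<le> (1 / 6)\<^sup>2" .
    have k: "\<bar>(?U ^^ k) e0 None - 1\<bar> \<le> 1 / 6" for k
    proof -
      have "e0 = (\<lambda>i. 1 * \<phi> x i + (- 1) * z i)" by (simp add: z_def)
      then have "(?U ^^ k) e0 None = (?U ^^ k) (\<phi> x) None - (?U ^^ k) z None"
        using Uk_linear[where a = 1 and u = "\<phi> x" and b = "- 1" and v = z] by simp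
      moreover have "(?U ^^ k) (\<phi> x) None = 1" using fixd[OF None] by (simp add: \<phi>_def)
      moreover have "\<bar>(?U ^^ k) z None\<bar> \<le> 1 / 6"
        using order_trans[OF Uk_bound z] by (simp add: abs_le_square_iff[symmetric])
      ultimately show ?thesis by simp
    qed
    have "q (\<lambda>i. of_bool (x i)) - 1 = (\<Sum>k<N. (?U ^^ k) e0 None - 1) / N"
      using Npos by (simp add: q_def sum_subtractf field_simps)
    also have "\<bar>\<dots>\<bar> \<le> (\<Sum>k<N. 1 / 6) / N"
      unfolding abs_divide abs_of_nat
      by (intro divide_right_mono order_trans[OF sum_abs] sum_mono k) simp
    also have "\<dots> = 1 / 6" using Npos by simp
    finally show ?thesis .
  qed
  have zero: "\<bar>q (\<lambda>i. of_bool (y i))\<bar> \<le> 1 / 6" if y: "y \<in> Q" "\<not> F y" for y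
  proof -
    let ?U = "U (\<lambda>i. of_bool (y i))"
    \<comment> \<open>\<open>M\<close> negates \<open>\<psi> y\<close>, and the signs negate it once
      more except at \<open>None\<close>. Thus \<open>\<psi> y\<close> and its image cancel outside
      \<open>None\<close> and add up there.\<close>
    have e0: "e0 i = (1 / 2) * \<psi> y i + (- 1 / 2) * ?U (\<psi> y) i" if "i \<in> I" for i
    proof -
      have "mat_app I M (\<psi> y) i = - \<psi> y i" using neg y that by auto
      then show ?thesis by (auto simp: U_def sg_def \<psi>_def e0_def split: option.split)
    qed
    define h where "h k = (?U ^^ k) (\<psi> y) None" for k
    have tele: "(?U ^^ k) e0 None = (h k - h (Suc k)) / 2" for k
    proof -
      have "(?U ^^ k) e0 None = (?U ^^ k) (\<lambda>i. (1 / 2) * \<psi> y i + (- 1 / 2) * ?U (\<psi> y) i) None"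
        using e0 None by (rule Uk_cong)
      also have "\<dots> = (h k - h (Suc k)) / 2"
        unfolding Uk_linear h_def funpow_Suc_right by (simp add: field_simps)
      finally show ?thesis .
    qed
    have "(\<Sum>i\<in>I. (\<psi> y i)\<^sup>2) = 1 + (\<Sum>j<n. (w y j)\<^sup>2) / \<delta>\<^sup>2"
      unfolding sumI sum_divide_distrib by (auto simp: \<psi>_def power_divide intro!: sum.cong)
    also have "\<dots> \<le> 1 + W / \<delta>\<^sup>2"
      by (intro add_left_mono divide_right_mono size) simp
    also have "\<dots> = 1 + 36 * W\<^sup>2" unfolding \<delta>(2) using W by (simp add: power2_eq_square)
    also have "\<dots> \<le> 37 * W\<^sup>2" using one_le_power[OF W, of 2] by simp
    also have "\<dots> \<le> (37 * W / 6)\<^sup>2" by (simp add: power_divide power_mult_distrib)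
    finally have \<psi>: "(\<Sum>i\<in>I. (\<psi> y i)\<^sup>2) \<le> (37 * W / 6)\<^sup>2" .
    have h: "\<bar>h k\<bar> \<le> real N / 6" for k
    proof -
      have "\<bar>h k\<bar> \<le> 37 * W / 6"
        using order_trans[OF Uk_bound \<psi>] W by (simp add: abs_le_square_iff[symmetric] h_def)
      then show ?thesis using N by simp
    qed
    have "q (\<lambda>i. of_bool (y i)) = (h 0 - h N) / 2 / N"
      by (simp add: q_def tele sum_divide_distrib[symmetric] sum_lessThan_telescope')
    moreover have "\<bar>(h 0 - h N) / 2\<bar> \<le> real N / 6"
      using h[of 0] h[of N] abs_triangle_ineq4[of "h 0" "h N"] by simp
    ultimately show ?thesis using Npos by (simp only: abs_divide abs_of_nat pos_divide_le_eq)
  qed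

  \<comment> \<open>The affine map sends [-1/6, 1/6] to [0, 1/4] and [5/6, 7/6] to [3/4, 1], since
    an approximant must stay within [0, 1].\<close>
  define p where "p x = 3 / 4 * q x + 1 / 8" for x
  have polyp: "poly_deg_le n N p"
    unfolding p_def[abs_def] by (intro poly_deg_le_add poly_deg_le_cmult polyq poly_deg_le_const)
  have "approximates p F"
    unfolding approximates_def Let_def
  proof
    fix x :: "nat \<Rightarrow> bool"
    define y where "y i = (i < n \<and> x i)" for i
    have y: "y \<in> Q" by (simp add: Q_def y_def)
    have F: "F x = F y" by (rule dep) (simp add: y_def)
    have q: "q (\<lambda>i. of_bool (x i)) = q (\<lambda>i. of_bool (y i))"
      by (rule poly_deg_le_cong[OF polyq]) (simp add: y_def)
    show "(F x \<longrightarrow> 2 / 3 \<le> p (\<lambda>i. of_bool (x i)) \<and> p (\<lambda>i. of_bool (x i)) \<le> 1) \<and>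
        (\<not> F x \<longrightarrow> 0 \<le> p (\<lambda>i. of_bool (x i)) \<and> p (\<lambda>i. of_bool (x i)) \<le> 1 / 3)"
    proof (cases "F y")
      case True
      then have "5 / 6 \<le> q (\<lambda>i. of_bool (y i))" "q (\<lambda>i. of_bool (y i)) \<le> 7 / 6"
        using one[OF y] by linarith+
      then show ?thesis using True unfolding p_def q F by simp
    next
      case False
      then have "- 1 / 6 \<le> q (\<lambda>i. of_bool (y i))" "q (\<lambda>i. of_bool (y i)) \<le> 1 / 6"
        using zero[OF y] by linarith+
      then show ?thesis using False unfolding p_def q F by simp
    qed
  qed
  with polyp show ?thesis by blast
qed

lemma read_once_fun_approx_upper:
  assumes "read_once_fun {..<n} F"
  shows "\<exists>d q. real d \<le> 38 * sqrt n \<and> poly_deg_le n d q \<and> approximates q F"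
proof -
  have n: "n \<ge> 1" using read_once_fun_finite[OF assms] by (cases n) auto
  obtain w :: "(nat \<Rightarrow> bool) \<Rightarrow> nat \<Rightarrow> real" where w:
    "\<And>x y. F x \<Longrightarrow> \<not> F y \<Longrightarrow> (\<Sum>j<n. of_bool (x j \<noteq> y j) * (w x j * w y j)) = 1"
    "\<And>x. (\<Sum>j<n. (w x j)\<^sup>2) \<le> sqrt n"
    using read_once_fun_dual_adversary[OF assms] by auto
  \<comment> \<open>Rounding up costs at most 1, hence at most \<open>sqrt n\<close>; this turns 37
    into 38.\<close>
  define N where "N = nat \<lceil>37 * sqrt n\<rceil>"
  have N: "37 * sqrt n \<le> N" "N \<le> 37 * sqrt n + 1"
    by (auto simp: N_def of_nat_ceiling)
  have "1 \<le> sqrt n" using n by simp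
  have "\<exists>q. poly_deg_le n N q \<and> approximates q F"
    by (rule dual_adversary_imp_approx[OF _ w \<open>1 \<le> sqrt n\<close> N(1)])
      (auto intro!: read_once_fun_cong[OF assms])
  moreover have "real N \<le> 38 * sqrt n" using N(2) \<open>1 \<le> sqrt n\<close> by linarith
  ultimately show ?thesis by blast
qed

section \<open>Lower bound\<close>

text \<open>For the lower bound an input is the set of its true variables, so the cube is
  \<open>Pow S\<close> and sums over it are finite; \<open>toggle j\<close> moves along an edge in
  direction \<open>j\<close>.\<close>

definition toggle :: "nat \<Rightarrow> nat set \<Rightarrow> nat set" where
  "toggle j X = (if j \<in> X then X - {j} else insert j X)"

lemma toggle_toggle: "toggle j (toggle j X) = X"
  by (auto simp: toggle_def)

lemma toggle_subset: "j \<in> S \<Longrightarrow> toggle j X \<subseteq> S \<longleftrightarrow> X \<subseteq> S"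
  by (auto simp: toggle_def)

lemma sum_toggle:
  assumes "j \<in> S"
  shows "(\<Sum>X\<in>Pow S. f (toggle j X)) = (\<Sum>X\<in>Pow S. f X)"
  by (rule sum.reindex_bij_witness[of _ "toggle j" "toggle j"])
    (use assms in \<open>auto simp: toggle_toggle toggle_subset Pow_def\<close>)

text \<open>Nonnegative unit vectors witnessing that the spectral norm of the sensitivity graph is at
  least \<open>sqrt (card S)\<close>.\<close>

lemma read_once_fun_sensitivity:
  assumes "read_once_fun S F"
  shows "\<exists>u v :: nat set \<Rightarrow> real. (\<forall>X. 0 \<le> u X \<and> 0 \<le> v X) \<and>
    (\<forall>X\<subseteq>S. (u X \<noteq> 0 \<longrightarrow> \<not> F (\<lambda>i. i \<in> X)) \<and> (v X \<noteq> 0 \<longrightarrow> F (\<lambda>i. i \<in> X))) \<and>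
    (\<Sum>X\<in>Pow S. (u X)\<^sup>2) = 1 \<and> (\<Sum>X\<in>Pow S. (v X)\<^sup>2) = 1 \<and>
    sqrt (card S) \<le> (\<Sum>X\<in>Pow S. \<Sum>j\<in>S. u X * v (toggle j X))"
  using assms
proof (induction rule: read_once_fun.induct)
  case (var i)
  have "Pow {i} = {{}, {i}}" by auto
  then show ?case
    by (intro exI[of _ "\<lambda>X. of_bool (i \<notin> X)"] exI[of _ "\<lambda>X. of_bool (i \<in> X)"])
      (simp add: toggle_def)
next
  case (neg S F)
  then obtain u v :: "nat set \<Rightarrow> real" where uv: "\<forall>X. 0 \<le> u X \<and> 0 \<le> v X"
    "\<forall>X\<subseteq>S. (u X \<noteq> 0 \<longrightarrow> \<not> F (\<lambda>i. i \<in> X)) \<and> (v X \<noteq> 0 \<longrightarrow> F (\<lambda>i. i \<in> X))"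
    "(\<Sum>X\<in>Pow S. (u X)\<^sup>2) = 1" "(\<Sum>X\<in>Pow S. (v X)\<^sup>2) = 1"
    "sqrt (card S) \<le> (\<Sum>X\<in>Pow S. \<Sum>j\<in>S. u X * v (toggle j X))" by blast
  \<comment> \<open>Every edge may be read from its other end, so the two vectors can trade places
    under negation.\<close>
  have "(\<Sum>X\<in>Pow S. u X * v (toggle j X)) = (\<Sum>X\<in>Pow S. v X * u (toggle j X))" if "j \<in> S" for j
    using sum_toggle[OF that, of "\<lambda>X. u X * v (toggle j X)"] by (simp add: toggle_toggle mult.commute)
  then have "(\<Sum>X\<in>Pow S. \<Sum>j\<in>S. u X * v (toggle j X)) = (\<Sum>X\<in>Pow S. \<Sum>j\<in>S. v X * u (toggle j X))"
    by (simp add: sum.swap[of _ _ "Pow S"])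
  then show ?case using uv by (intro exI[of _ v] exI[of _ u]) auto
next
  case (conj S F T G)
  obtain u v :: "nat set \<Rightarrow> real" where uv: "\<forall>X. 0 \<le> u X \<and> 0 \<le> v X"
    "\<forall>X\<subseteq>S. (u X \<noteq> 0 \<longrightarrow> \<not> F (\<lambda>i. i \<in> X)) \<and> (v X \<noteq> 0 \<longrightarrow> F (\<lambda>i. i \<in> X))"
    "(\<Sum>X\<in>Pow S. (u X)\<^sup>2) = 1" "(\<Sum>X\<in>Pow S. (v X)\<^sup>2) = 1"
    "sqrt (card S) \<le> (\<Sum>X\<in>Pow S. \<Sum>j\<in>S. u X * v (toggle j X))" using conj.IH(1) by blast
  obtain u' v' :: "nat set \<Rightarrow> real" where uv': "\<forall>X. 0 \<le> u' X \<and> 0 \<le> v' X"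
    "\<forall>X\<subseteq>T. (u' X \<noteq> 0 \<longrightarrow> \<not> G (\<lambda>i. i \<in> X)) \<and> (v' X \<noteq> 0 \<longrightarrow> G (\<lambda>i. i \<in> X))"
    "(\<Sum>X\<in>Pow T. (u' X)\<^sup>2) = 1" "(\<Sum>X\<in>Pow T. (v' X)\<^sup>2) = 1"
    "sqrt (card T) \<le> (\<Sum>X\<in>Pow T. \<Sum>j\<in>T. u' X * v' (toggle j X))" using conj.IH(2) by blast
  note fin = read_once_fun_finite[OF conj.hyps(1)] read_once_fun_finite[OF conj.hyps(2)]
  note disj = conj.hyps(3)
  define a b n where "a = real (card S)" and "b = real (card T)" and "n = real (card (S \<union> T))"
  have pos: "a > 0" "b > 0" using fin by (auto simp: a_def b_def card_gt_0_iff)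
  have n: "n = a + b" using fin disj by (simp add: a_def b_def n_def card_Un_disjoint)
  \<comment> \<open>The unit vector of weights with equality in Cauchy-Schwarz for
    \<open>\<alpha> * sqrt a + \<beta> * sqrt b\<close>.\<close>
  define \<alpha> \<beta> where "\<alpha> = sqrt (a / n)" and "\<beta> = sqrt (b / n)"
  have ab: "\<alpha> \<ge> 0" "\<beta> \<ge> 0" "\<alpha>\<^sup>2 + \<beta>\<^sup>2 = 1" "\<alpha> * sqrt a + \<beta> * sqrt b = sqrt n"
  proof -
    show "\<alpha> \<ge> 0" "\<beta> \<ge> 0" using pos n by (auto simp: \<alpha>_def \<beta>_def)
    show "\<alpha>\<^sup>2 + \<beta>\<^sup>2 = 1" using pos n by (simp add: \<alpha>_def \<beta>_def add_divide_distrib[symmetric])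
    have "\<alpha> * sqrt a + \<beta> * sqrt b = n / sqrt n"
      using pos n by (simp add: \<alpha>_def \<beta>_def real_sqrt_divide add_divide_distrib)
    then show "\<alpha> * sqrt a + \<beta> * sqrt b = sqrt n" using pos n by (simp add: real_div_sqrt)
  qed
  have sumU: "(\<Sum>X\<in>Pow (S \<union> T). h (X \<inter> S) (X \<inter> T)) = (\<Sum>X\<in>Pow S. \<Sum>Y\<in>Pow T. h X Y)"
    for h :: "nat set \<Rightarrow> nat set \<Rightarrow> real"
  proof -
    have "(\<Sum>X\<in>Pow (S \<union> T). h (X \<inter> S) (X \<inter> T)) = (\<Sum>(X, Y)\<in>Pow S \<times> Pow T. h X Y)"
      by (rule sum.reindex_bij_witness[of _ "\<lambda>(X, Y). X \<union> Y" "\<lambda>X. (X \<inter> S, X \<inter> T)"])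
        (use disj in auto)
    then show ?thesis by (simp add: sum.cartesian_product)
  qed
  have togS: "toggle j X \<inter> S = toggle j (X \<inter> S)" "toggle j X \<inter> T = X \<inter> T" if "j \<in> S" for j X
    using that disj by (auto simp: toggle_def)
  have togT: "toggle j X \<inter> T = toggle j (X \<inter> T)" "toggle j X \<inter> S = X \<inter> S" if "j \<in> T" for j X
    using that disj by (auto simp: toggle_def)
  have FS: "F (\<lambda>i. i \<in> X) = F (\<lambda>i. i \<in> X \<inter> S)" for X
    by (rule read_once_fun_cong[OF conj.hyps(1)]) auto
  have GT: "G (\<lambda>i. i \<in> X) = G (\<lambda>i. i \<in> X \<inter> T)" for X
    by (rule read_once_fun_cong[OF conj.hyps(2)]) auto
  \<comment> \<open>Zeros of the conjunction carry weight only where exactly one conjunct fails: a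
    flip reaching a one of the conjunction must repair that conjunct.\<close>
  define p where "p X = \<alpha> * (u (X \<inter> S) * v' (X \<inter> T)) + \<beta> * (v (X \<inter> S) * u' (X \<inter> T))" for X
  define q where "q X = v (X \<inter> S) * v' (X \<inter> T)" for X
  have nonneg: "0 \<le> p X \<and> 0 \<le> q X" for X
    using uv(1) uv'(1) ab(1,2) by (simp add: p_def q_def)
  have supp: "(p X \<noteq> 0 \<longrightarrow> \<not> (F (\<lambda>i. i \<in> X) \<and> G (\<lambda>i. i \<in> X))) \<and>
      (q X \<noteq> 0 \<longrightarrow> F (\<lambda>i. i \<in> X) \<and> G (\<lambda>i. i \<in> X))" for X
    using uv(2)[rule_format, of "X \<inter> S"] uv'(2)[rule_format, of "X \<inter> T"]
    unfolding FS[of X] GT[of X] by (auto simp: p_def q_def)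
  have prods: "(\<Sum>X\<in>Pow S. \<Sum>Y\<in>Pow T. f X * g Y) = (\<Sum>X\<in>Pow S. f X) * (\<Sum>Y\<in>Pow T. g Y)"
    for f g :: "nat set \<Rightarrow> real"
    by (simp add: sum_product)
  have normq: "(\<Sum>X\<in>Pow (S \<union> T). (q X)\<^sup>2) = 1"
  proof -
    have "(\<Sum>X\<in>Pow (S \<union> T). (q X)\<^sup>2) = (\<Sum>X\<in>Pow S. \<Sum>Y\<in>Pow T. (v X)\<^sup>2 * (v' Y)\<^sup>2)"
      unfolding sumU[symmetric] by (simp add: q_def power_mult_distrib)
    then show ?thesis unfolding prods using uv uv' by simp
  qed
  have normp: "(\<Sum>X\<in>Pow (S \<union> T). (p X)\<^sup>2) = 1"
  proof -
    \<comment> \<open>The supports are disjoint, so the two summands of \<open>p\<close> are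
      orthogonal.\<close>
    have "u X * v X = 0" if "X \<subseteq> S" for X using uv(2) that by auto
    then have cross: "u (X \<inter> S) * v (X \<inter> S) = 0" for X by simp
    have "(p X)\<^sup>2 = \<alpha>\<^sup>2 * ((u (X \<inter> S))\<^sup>2 * (v' (X \<inter> T))\<^sup>2) + \<beta>\<^sup>2 * ((v (X \<inter> S))\<^sup>2 * (u' (X \<inter> T))\<^sup>2)"
      for X
      using cross[of X] by (auto simp: p_def power_mult_distrib)
    then have "(\<Sum>X\<in>Pow (S \<union> T). (p X)\<^sup>2) =
        \<alpha>\<^sup>2 * (\<Sum>X\<in>Pow S. \<Sum>Y\<in>Pow T. (u X)\<^sup>2 * (v' Y)\<^sup>2) +
        \<beta>\<^sup>2 * (\<Sum>X\<in>Pow S. \<Sum>Y\<in>Pow T. (v X)\<^sup>2 * (u' Y)\<^sup>2)"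
      unfolding sumU[symmetric] by (simp add: sum.distrib sum_distrib_left)
    then show ?thesis unfolding prods using uv uv' ab(3) by simp
  qed
  have "sqrt n \<le> \<alpha> * (\<Sum>X\<in>Pow S. \<Sum>j\<in>S. u X * v (toggle j X)) +
      \<beta> * (\<Sum>Y\<in>Pow T. \<Sum>j\<in>T. u' Y * v' (toggle j Y))"
    unfolding ab(4)[symmetric] a_def b_def
    by (intro add_mono mult_left_mono uv(5) uv'(5) ab(1,2))
  also have "\<alpha> * (\<Sum>X\<in>Pow S. \<Sum>j\<in>S. u X * v (toggle j X)) =
      \<alpha> * (\<Sum>X\<in>Pow S. \<Sum>Y\<in>Pow T. (\<Sum>j\<in>S. u X * v (toggle j X)) * (v' Y)\<^sup>2)"
    unfolding prods uv'(4) by simp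
  also have "\<beta> * (\<Sum>Y\<in>Pow T. \<Sum>j\<in>T. u' Y * v' (toggle j Y)) =
      \<beta> * (\<Sum>X\<in>Pow S. \<Sum>Y\<in>Pow T. (v X)\<^sup>2 * (\<Sum>j\<in>T. u' Y * v' (toggle j Y)))"
    unfolding prods uv(4) by simp
  also have "\<alpha> * (\<Sum>X\<in>Pow S. \<Sum>Y\<in>Pow T. (\<Sum>j\<in>S. u X * v (toggle j X)) * (v' Y)\<^sup>2) + \<dots> =
      (\<Sum>X\<in>Pow (S \<union> T). (\<Sum>j\<in>S. \<alpha> * (u (X \<inter> S) * v' (X \<inter> T)) * q (toggle j X)) +
        (\<Sum>j\<in>T. \<beta> * (v (X \<inter> S) * u' (X \<inter> T)) * q (toggle j X)))"
    unfolding sumU[symmetric] sum_distrib_left sum_distrib_right sum.distrib[symmetric] q_def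
    by (intro sum.cong arg_cong2[of _ _ _ _ "(+)"])
      (auto simp: togS togT power2_eq_square)
  \<comment> \<open>By nonnegativity each summand of \<open>p\<close> may be enlarged to all of
    \<open>p\<close>.\<close>
  also have "\<dots> \<le> (\<Sum>X\<in>Pow (S \<union> T). (\<Sum>j\<in>S. p X * q (toggle j X)) + (\<Sum>j\<in>T. p X * q (toggle j X)))"
    using uv(1) uv'(1) ab(1,2) nonneg
    by (intro sum_mono add_mono mult_right_mono) (auto simp: p_def)
  also have "\<dots> = (\<Sum>X\<in>Pow (S \<union> T). \<Sum>j\<in>S \<union> T. p X * q (toggle j X))"
    using fin disj by (simp add: sum.union_disjoint)
  finally show ?case
    using nonneg supp normp normq unfolding n_def by (intro exI[of _ p] exI[of _ q]) blast
qed

section \<open>Fourier analysis on the cube\<close>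

definition walsh :: "nat set \<Rightarrow> nat set \<Rightarrow> real" where
  "walsh T X = (- 1) ^ card (T \<inter> X)"

lemma walsh_commute: "walsh T X = walsh X T"
  by (simp add: walsh_def Int_commute)

lemma walsh_square: "walsh T X * walsh T X = 1"
  by (simp add: walsh_def power_mult_distrib[symmetric])

lemma walsh_toggle_in:
  assumes "finite T" "j \<in> T"
  shows "walsh T (toggle j X) = - walsh T X"
proof -
  have *: "walsh T (insert j Y) = - walsh T Y" if "j \<notin> Y" for Y
    using assms that by (simp add: walsh_def)
  show ?thesis
  proof (cases "j \<in> X")
    case True
    then show ?thesis using *[of "X - {j}"] by (simp add: toggle_def insert_absorb)
  qed (simp add: toggle_def *)
qed

lemma walsh_toggle_notin: "j \<notin> T \<Longrightarrow> walsh T (toggle j X) = walsh T X"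
  by (auto simp: walsh_def toggle_def Int_Diff intro!: arg_cong[of _ _ "\<lambda>A. (- 1) ^ card A"])

lemma sum_zero_if_toggle_negates:
  fixes f :: "nat set \<Rightarrow> real"
  assumes "j \<in> S" "\<And>X. f (toggle j X) = - f X"
  shows "(\<Sum>X\<in>Pow S. f X) = 0"
  using sum_toggle[OF assms(1), of f] by (simp add: assms(2) sum_negf)

text \<open>For different index sets, flipping a coordinate in exactly one of them negates the
  product, so the terms cancel in pairs.\<close>

lemma walsh_orthogonal:
  assumes "finite S" "T \<subseteq> S" "T' \<subseteq> S"
  shows "(\<Sum>X\<in>Pow S. walsh T X * walsh T' X) = (if T = T' then 2 ^ card S else 0)"
proof (cases "T = T'")
  case True
  then show ?thesis using assms by (simp add: walsh_square card_Pow)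
next
  case False
  have fin: "finite T" "finite T'" using assms finite_subset by auto
  from False obtain j where j: "j \<in> T \<and> j \<notin> T' \<or> j \<in> T' \<and> j \<notin> T" by blast
  have "(\<Sum>X\<in>Pow S. walsh T X * walsh T' X) = 0"
    by (rule sum_zero_if_toggle_negates[of j])
      (use j assms fin in \<open>auto simp: walsh_toggle_in walsh_toggle_notin\<close>)
  then show ?thesis using False by simp
qed

lemma walsh_parseval:
  assumes "finite S"
  shows "(\<Sum>X\<in>Pow S. (\<Sum>T\<in>Pow S. a T * walsh T X)\<^sup>2) = 2 ^ card S * (\<Sum>T\<in>Pow S. (a T)\<^sup>2)"
proof -
  have "(\<Sum>X\<in>Pow S. (\<Sum>T\<in>Pow S. a T * walsh T X)\<^sup>2) =
      (\<Sum>X\<in>Pow S. \<Sum>T\<in>Pow S. \<Sum>T'\<in>Pow S. a T * a T' * (walsh T X * walsh T' X))"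
    by (simp add: power2_eq_square sum_product mult_ac)
  also have "\<dots> = (\<Sum>T\<in>Pow S. \<Sum>X\<in>Pow S. \<Sum>T'\<in>Pow S. a T * a T' * (walsh T X * walsh T' X))"
    by (rule sum.swap)
  also have "\<dots> = (\<Sum>T\<in>Pow S. \<Sum>T'\<in>Pow S. \<Sum>X\<in>Pow S. a T * a T' * (walsh T X * walsh T' X))"
    by (intro sum.cong refl sum.swap)
  also have "\<dots> = (\<Sum>T\<in>Pow S. \<Sum>T'\<in>Pow S. if T = T' then a T * a T' * 2 ^ card S else 0)"
    unfolding sum_distrib_left[symmetric]
    by (intro sum.cong refl) (use assms in \<open>simp add: walsh_orthogonal\<close>)
  also have "\<dots> = (\<Sum>T\<in>Pow S. (a T)\<^sup>2 * 2 ^ card S)"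
    using assms by (intro sum.cong) (simp_all add: power2_eq_square)
  finally show ?thesis by (simp add: sum_distrib_left mult.commute)
qed

lemma walsh_expansion:
  fixes u :: "nat set \<Rightarrow> real"
  assumes "finite S"
  obtains a where "\<And>X. X \<subseteq> S \<Longrightarrow> u X = (\<Sum>T\<in>Pow S. a T * walsh T X)"
    and "2 ^ card S * (\<Sum>T\<in>Pow S. (a T)\<^sup>2) = (\<Sum>X\<in>Pow S. (u X)\<^sup>2)"
proof -
  define a where "a T = (\<Sum>Y\<in>Pow S. u Y * walsh T Y) / 2 ^ card S" for T
  have u: "u X = (\<Sum>T\<in>Pow S. a T * walsh T X)" if X: "X \<subseteq> S" for X
  proof -
    \<comment> \<open>Characters are symmetric in index set and point, so Fourier inversion follows
      from the same orthogonality relation with the roles exchanged.\<close>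
    have "(\<Sum>T\<in>Pow S. a T * walsh T X) * 2 ^ card S =
        (\<Sum>T\<in>Pow S. \<Sum>Y\<in>Pow S. u Y * (walsh Y T * walsh X T))"
      unfolding sum_distrib_right
    proof (intro sum.cong refl)
      fix T
      have "a T * walsh T X * 2 ^ card S = (\<Sum>Y\<in>Pow S. u Y * walsh T Y) * walsh T X"
        by (simp add: a_def)
      also have "\<dots> = (\<Sum>Y\<in>Pow S. u Y * (walsh Y T * walsh X T))"
        unfolding sum_distrib_right by (simp only: walsh_commute[of T] mult.assoc)
      finally show "a T * walsh T X * 2 ^ card S = (\<Sum>Y\<in>Pow S. u Y * (walsh Y T * walsh X T))" .
    qed
    also have "\<dots> = (\<Sum>Y\<in>Pow S. u Y * (\<Sum>T\<in>Pow S. walsh Y T * walsh X T))"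
      unfolding sum_distrib_left by (rule sum.swap)
    also have "\<dots> = (\<Sum>Y\<in>Pow S. if Y = X then u Y * 2 ^ card S else 0)"
      by (intro sum.cong refl) (use assms X in \<open>simp add: walsh_orthogonal\<close>)
    also have "\<dots> = u X * 2 ^ card S" using assms X by simp
    finally show ?thesis by simp
  qed
  have "(\<Sum>X\<in>Pow S. (u X)\<^sup>2) = (\<Sum>X\<in>Pow S. (\<Sum>T\<in>Pow S. a T * walsh T X)\<^sup>2)"
    by (intro sum.cong) (use u in auto)
  then show ?thesis using u walsh_parseval[OF assms, of a] that by simp
qed

text \<open>Characters are eigenvectors of the cube's adjacency operator: flips inside
  \<open>T\<close> change the sign, all others do nothing.\<close>

lemma sum_walsh_toggle:
  assumes "finite S" "T \<subseteq> S"
  shows "(\<Sum>j\<in>S. walsh T (toggle j X)) = (real (card S) - 2 * real (card T)) * walsh T X"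
proof -
  have fin: "finite T" using assms finite_subset by auto
  have "(\<Sum>j\<in>S. walsh T (toggle j X)) = (\<Sum>j\<in>S - T. walsh T (toggle j X)) + (\<Sum>j\<in>T. walsh T (toggle j X))"
    using assms by (rule sum.subset_diff[rotated])
  also have "\<dots> = real (card (S - T)) * walsh T X - real (card T) * walsh T X"
    using fin by (simp add: walsh_toggle_in walsh_toggle_notin)
  also have "real (card (S - T)) = real (card S) - real (card T)"
    using assms fin by (simp add: card_Diff_subset card_mono of_nat_diff)
  finally show ?thesis by (simp add: algebra_simps)
qed

section \<open>Low-degree polynomials and the commutator bound\<close>

text \<open>Since \<open>T' - T\<close> has more than \<open>d\<close> elements, each monomial
  misses some \<open>j\<close> in it; flipping \<open>j\<close> keeps the monomial and negates the
  product of characters.\<close>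

lemma poly_deg_le_walsh_band:
  assumes q: "poly_deg_le n d q" and TT: "T \<subseteq> {..<n}" "T' \<subseteq> {..<n}" and d: "card T + d < card T'"
  shows "(\<Sum>X\<in>Pow {..<n}. q (\<lambda>i. of_bool (i \<in> X)) * (walsh T X * walsh T' X)) = 0"
proof -
  have fin: "finite T" "finite T'" using TT finite_subset by auto
  obtain M c where M: "finite M" "\<And>m. m \<in> M \<Longrightarrow> (\<Sum>i<n. m i) \<le> d"
    "\<And>x. q x = (\<Sum>m\<in>M. c m * (\<Prod>i<n. x i ^ m i))"
    using q unfolding poly_deg_le_def by blast
  have mono: "(\<Sum>X\<in>Pow {..<n}. (\<Prod>i<n. of_bool (i \<in> X) ^ m i) * (walsh T X * walsh T' X)) = 0"
    if "m \<in> M" for m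
  proof -
    obtain j where j: "j \<in> T'" "j \<notin> T" "m j = 0"
    proof (rule ccontr)
      assume "\<not> thesis"
      then have "\<forall>j\<in>T' - T. 1 \<le> m j" using that by (metis Diff_iff One_nat_def Suc_leI neq0_conv)
      then have "card (T' - T) \<le> (\<Sum>j\<in>T' - T. m j)"
        using sum_mono[of "T' - T" "\<lambda>_. 1" m] by simp
      also have "\<dots> \<le> (\<Sum>i<n. m i)" using TT by (intro sum_mono2) auto
      also have "\<dots> \<le> d" using M(2) \<open>m \<in> M\<close> by blast
      finally show False using d diff_card_le_card_Diff[OF fin(1), of T'] by linarith
    qed
    have "(\<Prod>i<n. of_bool (i \<in> toggle j X) ^ m i) = (\<Prod>i<n. (of_bool (i \<in> X) :: real) ^ m i)" for X
      using j(3) by (intro prod.cong) (auto simp: toggle_def)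
    then show ?thesis
      using j TT fin
      by (intro sum_zero_if_toggle_negates[of j]) (auto simp: walsh_toggle_in walsh_toggle_notin)
  qed
  have "(\<Sum>X\<in>Pow {..<n}. q (\<lambda>i. of_bool (i \<in> X)) * (walsh T X * walsh T' X)) =
      (\<Sum>m\<in>M. c m * (\<Sum>X\<in>Pow {..<n}. (\<Prod>i<n. of_bool (i \<in> X) ^ m i) * (walsh T X * walsh T' X)))"
    unfolding M(3) sum_distrib_left sum_distrib_right
    by (subst sum.swap) (simp add: mult.assoc)
  also have "\<dots> = 0" using mono by simp
  finally show ?thesis .
qed

text \<open>The bilinear form of the commutator of the cube's adjacency operator with multiplication by
  \<open>q\<close>. In the Walsh basis the former is diagonal and the latter couples only levels \<open>l\<close>, \<open>k\<close>
  with \<open>\<bar>k - l\<bar> \<le> d\<close>; on such pairs \<open>k - l + d\<close> is the number of common points of the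
  intervals \<open>{k..<k + 2 * d}\<close> and \<open>{l + d..<l + 3 * d}\<close>, a Gram representation that bounds the
  Schur multiplier \<open>k - l\<close>.\<close>

lemma sensitivity_commutator_le:
  fixes u v r :: "nat set \<Rightarrow> real"
  assumes q: "poly_deg_le n d q" and r: "\<And>X. r X = q (\<lambda>i. of_bool (i \<in> X))"
    and bound: "\<And>X. \<bar>r X\<bar> \<le> 1"
    and u: "(\<Sum>X\<in>Pow {..<n}. (u X)\<^sup>2) = 1" and v: "(\<Sum>X\<in>Pow {..<n}. (v X)\<^sup>2) = 1"
    and uv: "\<And>X. X \<subseteq> {..<n} \<Longrightarrow> u X * v X = 0"
  shows "(\<Sum>X\<in>Pow {..<n}. \<Sum>j<n. u X * v (toggle j X) * (r (toggle j X) - r X)) \<le> 4 * real d"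
proof -
  define S where "S = {..<n}"
  have fin: "finite S" and card: "card S = n" by (simp_all add: S_def)
  note u = u[folded S_def] and v = v[folded S_def] and uv = uv[folded S_def]
  obtain a where a: "\<And>X. X \<subseteq> S \<Longrightarrow> u X = (\<Sum>T\<in>Pow S. a T * walsh T X)"
    and a2: "2 ^ card S * (\<Sum>T\<in>Pow S. (a T)\<^sup>2) = 1"
    using walsh_expansion[OF fin, of u, unfolded u] by blast
  obtain b where b: "\<And>X. X \<subseteq> S \<Longrightarrow> v X = (\<Sum>T\<in>Pow S. b T * walsh T X)"
    and b2: "2 ^ card S * (\<Sum>T\<in>Pow S. (b T)\<^sup>2) = 1"
    using walsh_expansion[OF fin, of v, unfolded v] by blast
  \<comment> \<open>Up to the factor \<open>2 ^ card S\<close>, the matrix of multiplication by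
    \<open>r\<close> in the Walsh basis.\<close>
  define R where "R T T' = (\<Sum>X\<in>Pow S. r X * (walsh T X * walsh T' X))" for T T'
  have R: "R T T' = 0" if "T \<subseteq> S" "T' \<subseteq> S" "card T + d < card T' \<or> card T' + d < card T" for T T'
    using poly_deg_le_walsh_band[OF q, of T T'] poly_deg_le_walsh_band[OF q, of T' T] that
    by (auto simp: R_def r S_def mult.commute)
  have form: "(\<Sum>X\<in>Pow S. r X * ((\<Sum>T\<in>Pow S. f T * walsh T X) * (\<Sum>T'\<in>Pow S. g T' * walsh T' X))) =
      (\<Sum>T\<in>Pow S. \<Sum>T'\<in>Pow S. f T * g T' * R T T')" for f g
  proof -
    have "(\<Sum>X\<in>Pow S. r X * ((\<Sum>T\<in>Pow S. f T * walsh T X) * (\<Sum>T'\<in>Pow S. g T' * walsh T' X))) =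
        (\<Sum>X\<in>Pow S. \<Sum>T\<in>Pow S. \<Sum>T'\<in>Pow S. f T * g T' * (r X * (walsh T X * walsh T' X)))"
      unfolding sum_product unfolding sum_distrib_left by (intro sum.cong refl) (simp add: mult_ac)
    also have "\<dots> = (\<Sum>T\<in>Pow S. \<Sum>X\<in>Pow S. \<Sum>T'\<in>Pow S. f T * g T' * (r X * (walsh T X * walsh T' X)))"
      by (rule sum.swap)
    also have "\<dots> = (\<Sum>T\<in>Pow S. \<Sum>T'\<in>Pow S. \<Sum>X\<in>Pow S. f T * g T' * (r X * (walsh T X * walsh T' X)))"
      by (intro sum.cong refl sum.swap)
    finally show ?thesis by (simp add: R_def sum_distrib_left)
  qed
  \<comment> \<open>Multiplication by a function bounded by 1 is a contraction; the inequality
    between geometric and arithmetic mean, applied pointwise, combines with Parseval.\<close>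
  have form_le: "(\<Sum>T\<in>Pow S. \<Sum>T'\<in>Pow S. f T * g T' * R T T') \<le>
      2 ^ card S * ((\<Sum>T\<in>Pow S. (f T)\<^sup>2) + (\<Sum>T\<in>Pow S. (g T)\<^sup>2)) / 2" for f g
  proof -
    have "r X * (s * t) \<le> (s\<^sup>2 + t\<^sup>2) / 2" for X s t
    proof -
      have "r X * (s * t) \<le> \<bar>r X\<bar> * \<bar>s * t\<bar>" by (metis abs_ge_self abs_mult)
      also have "\<dots> \<le> \<bar>s * t\<bar>" using bound[of X] by (simp add: mult_left_le_one_le)
      also have "\<dots> \<le> (s\<^sup>2 + t\<^sup>2) / 2"
        using sum_squares_bound[of s t] sum_squares_bound[of "- s" t] by (simp add: abs_if)
      finally show ?thesis .
    qed
    then have "(\<Sum>X\<in>Pow S. r X * ((\<Sum>T\<in>Pow S. f T * walsh T X) * (\<Sum>T'\<in>Pow S. g T' * walsh T' X))) \<le>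
        (\<Sum>X\<in>Pow S. ((\<Sum>T\<in>Pow S. f T * walsh T X)\<^sup>2 + (\<Sum>T'\<in>Pow S. g T' * walsh T' X)\<^sup>2) / 2)"
      by (intro sum_mono)
    also have "\<dots> = 2 ^ card S * ((\<Sum>T\<in>Pow S. (f T)\<^sup>2) + (\<Sum>T\<in>Pow S. (g T)\<^sup>2)) / 2"
      unfolding sum_divide_distrib[symmetric] sum.distrib walsh_parseval[OF fin]
      by (simp add: algebra_simps)
    finally show ?thesis unfolding form .
  qed
  have adj: "(\<Sum>j\<in>S. h (toggle j X)) = (\<Sum>T\<in>Pow S. c T * (real n - 2 * real (card T)) * walsh T X)"
    if h: "\<And>X. X \<subseteq> S \<Longrightarrow> h X = (\<Sum>T\<in>Pow S. c T * walsh T X)" and X: "X \<subseteq> S" for h c X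
  proof -
    have "(\<Sum>j\<in>S. h (toggle j X)) = (\<Sum>j\<in>S. \<Sum>T\<in>Pow S. c T * walsh T (toggle j X))"
      using X by (intro sum.cong refl h) (simp add: toggle_subset)
    also have "\<dots> = (\<Sum>T\<in>Pow S. c T * (\<Sum>j\<in>S. walsh T (toggle j X)))"
      unfolding sum_distrib_left by (rule sum.swap)
    also have "\<dots> = (\<Sum>T\<in>Pow S. c T * (real n - 2 * real (card T)) * walsh T X)"
      by (intro sum.cong) (use fin card in \<open>auto simp: sum_walsh_toggle mult.assoc\<close>)
    finally show ?thesis .
  qed
  have "(\<Sum>X\<in>Pow S. u X * v (toggle j X) * (r (toggle j X) - r X)) =
      (\<Sum>X\<in>Pow S. r X * (u (toggle j X) * v X)) - (\<Sum>X\<in>Pow S. r X * (u X * v (toggle j X)))"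
    if "j \<in> S" for j
    using sum_toggle[OF that, of "\<lambda>X. u X * v (toggle j X) * r (toggle j X)"]
    by (simp add: toggle_toggle right_diff_distrib sum_subtractf mult_ac)
  then have "(\<Sum>X\<in>Pow S. \<Sum>j\<in>S. u X * v (toggle j X) * (r (toggle j X) - r X)) =
      (\<Sum>j\<in>S. (\<Sum>X\<in>Pow S. r X * (u (toggle j X) * v X)) - (\<Sum>X\<in>Pow S. r X * (u X * v (toggle j X))))"
    by (subst sum.swap) simp
  also have "\<dots> = (\<Sum>X\<in>Pow S. \<Sum>j\<in>S. r X * (u (toggle j X) * v X)) -
      (\<Sum>X\<in>Pow S. \<Sum>j\<in>S. r X * (u X * v (toggle j X)))"
    unfolding sum_subtractf by (intro arg_cong2[of _ _ _ _ "(-)"] sum.swap)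
  also have "(\<Sum>X\<in>Pow S. \<Sum>j\<in>S. r X * (u (toggle j X) * v X)) =
      (\<Sum>X\<in>Pow S. r X * ((\<Sum>T\<in>Pow S. a T * (real n - 2 * real (card T)) * walsh T X) *
        (\<Sum>T'\<in>Pow S. b T' * walsh T' X)))"
    unfolding sum_distrib_left[symmetric] sum_distrib_right[symmetric]
    by (intro sum.cong) (simp_all add: adj[OF a] b)
  also have "(\<Sum>X\<in>Pow S. \<Sum>j\<in>S. r X * (u X * v (toggle j X))) =
      (\<Sum>X\<in>Pow S. r X * ((\<Sum>T\<in>Pow S. a T * walsh T X) *
        (\<Sum>T'\<in>Pow S. b T' * (real n - 2 * real (card T')) * walsh T' X)))"
    unfolding sum_distrib_left[symmetric]
    by (intro sum.cong) (simp_all add: adj[OF b] a)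
  \<comment> \<open>The adjacency operator acts once on the left vector and once on the right one;
    the eigenvalues differ by \<open>2 * (card T' - card T)\<close>.\<close>
  also have "(\<Sum>X\<in>Pow S. r X * ((\<Sum>T\<in>Pow S. a T * (real n - 2 * real (card T)) * walsh T X) *
        (\<Sum>T'\<in>Pow S. b T' * walsh T' X))) - \<dots> =
      (\<Sum>T\<in>Pow S. \<Sum>T'\<in>Pow S. 2 * (a T * b T' * R T T' * (real (card T') - real (card T))))"
    unfolding form sum_subtractf[symmetric] by (simp add: algebra_simps)
  \<comment> \<open>The level difference is shifted by \<open>d\<close> to become a nonnegative
    count of points \<open>m\<close>, and the shift is subtracted again. As levels are at most
    \<open>n\<close>, all intervals lie below \<open>n + 3 * d\<close>.\<close>
  also have "\<dots> = (\<Sum>T\<in>Pow S. \<Sum>T'\<in>Pow S. 2 * (\<Sum>m<n + 3 * d.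
        (a T * of_bool (m \<in> {card T + d..<card T + 3 * d})) *
        (b T' * of_bool (m \<in> {card T'..<card T' + 2 * d})) * R T T') -
        2 * real d * (a T * b T' * R T T'))"
  proof (intro sum.cong refl)
    fix T T' assume T: "T \<in> Pow S" "T' \<in> Pow S"
    have c: "card T \<le> n" "card T' \<le> n" using T card card_mono[OF fin] by auto
    show "2 * (a T * b T' * R T T' * (real (card T') - real (card T))) =
      2 * (\<Sum>m<n + 3 * d. (a T * of_bool (m \<in> {card T + d..<card T + 3 * d})) *
        (b T' * of_bool (m \<in> {card T'..<card T' + 2 * d})) * R T T') -
        2 * real d * (a T * b T' * R T T')"
    proof (cases "card T + d < card T' \<or> card T' + d < card T")
      case True
      then show ?thesis using R[of T T'] T by simp
    next
      case False
      let ?A = "{card T + d..<card T + 3 * d} \<inter> {card T'..<card T' + 2 * d}"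
      have A: "?A = {card T + d..<card T' + 2 * d}" using False by auto
      have "(\<Sum>m<n + 3 * d. (a T * of_bool (m \<in> {card T + d..<card T + 3 * d})) *
          (b T' * of_bool (m \<in> {card T'..<card T' + 2 * d})) * R T T') =
          (\<Sum>m\<in>?A. a T * b T' * R T T')"
        using c by (intro sum.mono_neutral_cong_right) auto
      also have "\<dots> = (real (card T') - real (card T) + real d) * (a T * b T' * R T T')"
        unfolding A using False by (simp add: of_nat_diff)
      finally show ?thesis by (simp add: algebra_simps)
    qed
  qed
  also have "\<dots> = 2 * (\<Sum>T\<in>Pow S. \<Sum>T'\<in>Pow S. \<Sum>m<n + 3 * d.
        (a T * of_bool (m \<in> {card T + d..<card T + 3 * d})) *
        (b T' * of_bool (m \<in> {card T'..<card T' + 2 * d})) * R T T') -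
        2 * real d * (\<Sum>T\<in>Pow S. \<Sum>T'\<in>Pow S. a T * b T' * R T T')"
    by (simp add: sum_subtractf sum_distrib_left)
  \<comment> \<open>The shift costs nothing: this is the form of \<open>r\<close> on the pointwise
    product of \<open>u\<close> and \<open>v\<close>, which vanishes.\<close>
  also have "(\<Sum>T\<in>Pow S. \<Sum>T'\<in>Pow S. a T * b T' * R T T') = 0"
    unfolding form[symmetric] using uv by (intro sum.neutral) (simp add: a[symmetric] b[symmetric])
  also have "(\<Sum>T\<in>Pow S. \<Sum>T'\<in>Pow S. \<Sum>m<n + 3 * d.
        (a T * of_bool (m \<in> {card T + d..<card T + 3 * d})) *
        (b T' * of_bool (m \<in> {card T'..<card T' + 2 * d})) * R T T') =
      (\<Sum>m<n + 3 * d. \<Sum>T\<in>Pow S. \<Sum>T'\<in>Pow S.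
        (a T * of_bool (m \<in> {card T + d..<card T + 3 * d})) *
        (b T' * of_bool (m \<in> {card T'..<card T' + 2 * d})) * R T T')"
    unfolding sum.swap[of _ "{..<n + 3 * d}"] ..
  \<comment> \<open>For each \<open>m\<close> the contraction bound is applied to the two
    coefficient vectors cut down to the levels whose interval contains \<open>m\<close>.\<close>
  also have "2 * \<dots> - 2 * real d * 0 \<le> 2 * (\<Sum>m<n + 3 * d. 2 ^ card S *
      ((\<Sum>T\<in>Pow S. (a T * of_bool (m \<in> {card T + d..<card T + 3 * d}))\<^sup>2) +
       (\<Sum>T\<in>Pow S. (b T * of_bool (m \<in> {card T..<card T + 2 * d}))\<^sup>2)) / 2)"
    unfolding mult_zero_right diff_zero by (intro mult_left_mono sum_mono form_le) simp
  also have "\<dots> = 2 ^ card S * (\<Sum>m<n + 3 * d.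
      (\<Sum>T\<in>Pow S. (a T * of_bool (m \<in> {card T + d..<card T + 3 * d}))\<^sup>2) +
       (\<Sum>T\<in>Pow S. (b T * of_bool (m \<in> {card T..<card T + 2 * d}))\<^sup>2))"
    by (simp add: sum_distrib_left)
  \<comment> \<open>Each level survives the cut for exactly \<open>2 * d\<close> values of
    \<open>m\<close>.\<close>
  also have "\<dots> = 2 ^ card S * ((\<Sum>T\<in>Pow S. 2 * d * (a T)\<^sup>2) + (\<Sum>T\<in>Pow S. 2 * d * (b T)\<^sup>2))"
  proof -
    have count: "(\<Sum>m<n + 3 * d. (s * of_bool (m \<in> {k..<k + 2 * d}))\<^sup>2) = 2 * d * s\<^sup>2"
      if "k \<le> n + d" for k and s :: real
    proof -
      have "(\<Sum>m<n + 3 * d. (s * of_bool (m \<in> {k..<k + 2 * d}))\<^sup>2) = (\<Sum>m\<in>{k..<k + 2 * d}. s\<^sup>2)"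
        using that by (intro sum.mono_neutral_cong_right) auto
      then show ?thesis by simp
    qed
    have le: "card T \<le> n" if "T \<in> Pow S" for T
      using that card card_mono[OF fin, of T] by auto
    have "card T + 3 * d = card T + d + 2 * d" for T :: "nat set" by simp
    then show ?thesis
      unfolding sum.distrib sum.swap[of _ "Pow S" "{..<n + 3 * d}"]
      by (intro arg_cong2[of _ _ _ _ "(+)"] arg_cong[of _ _ "(*) _"] sum.cong refl)
        (simp_all only: count le add_le_cancel_right trans_le_add1)
  qed
  also have "\<dots> = 2 * d * (2 ^ card S * (\<Sum>T\<in>Pow S. (a T)\<^sup>2)) + 2 * d * (2 ^ card S * (\<Sum>T\<in>Pow S. (b T)\<^sup>2))"
    by (simp add: sum_distrib_left[symmetric] algebra_simps)
  also have "\<dots> = 4 * real d" unfolding a2 b2 by simp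
  finally show ?thesis unfolding S_def .
qed

text \<open>Along each edge of positive weight the approximant rises by at least 1/3 from a zero to
  a one. The commutator form is therefore at least \<open>sqrt n / 3\<close>, while it is at most
  \<open>4 * d\<close>.\<close>

lemma read_once_fun_approx_lower:
  assumes F: "read_once_fun {..<n} F" and q: "poly_deg_le n d q" "approximates q F"
  shows "sqrt n \<le> 12 * real d"
proof -
  obtain u v :: "nat set \<Rightarrow> real" where uv: "\<forall>X. 0 \<le> u X \<and> 0 \<le> v X"
    and supp: "\<forall>X\<subseteq>{..<n}. (u X \<noteq> 0 \<longrightarrow> \<not> F (\<lambda>i. i \<in> X)) \<and> (v X \<noteq> 0 \<longrightarrow> F (\<lambda>i. i \<in> X))"
    and norm: "(\<Sum>X\<in>Pow {..<n}. (u X)\<^sup>2) = 1" "(\<Sum>X\<in>Pow {..<n}. (v X)\<^sup>2) = 1"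
    and sens: "sqrt n \<le> (\<Sum>X\<in>Pow {..<n}. \<Sum>j<n. u X * v (toggle j X))"
    using read_once_fun_sensitivity[OF F, unfolded card_lessThan] by blast
  define p where "p X = q (\<lambda>i. of_bool (i \<in> X))" for X
  have p: "if F (\<lambda>i. i \<in> X) then 2 / 3 \<le> p X \<and> p X \<le> 1 else 0 \<le> p X \<and> p X \<le> 1 / 3" for X
    using q(2) unfolding approximates_def Let_def p_def by simp
  have gap: "u X * v (toggle j X) * (1 / 3) \<le> u X * v (toggle j X) * (p (toggle j X) - p X)"
    if "X \<subseteq> {..<n}" "j < n" for X j
  proof (cases "u X * v (toggle j X) = 0")
    case False
    have "toggle j X \<subseteq> {..<n}" using that by (simp add: toggle_subset)
    then have "\<not> F (\<lambda>i. i \<in> X)" "F (\<lambda>i. i \<in> toggle j X)" using False supp that by auto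
    then have "1 / 3 \<le> p (toggle j X) - p X" using p[of X] p[of "toggle j X"] by simp
    then show ?thesis using uv by (intro mult_left_mono) auto
  qed auto
  have "sqrt n * (1 / 3) \<le> (\<Sum>X\<in>Pow {..<n}. \<Sum>j<n. u X * v (toggle j X)) * (1 / 3)"
    using sens by simp
  also have "\<dots> \<le> (\<Sum>X\<in>Pow {..<n}. \<Sum>j<n. u X * v (toggle j X) * (p (toggle j X) - p X))"
    unfolding sum_distrib_right by (intro sum_mono gap) auto
  also have "\<dots> \<le> 4 * real d"
  proof (rule sensitivity_commutator_le[OF q(1) p_def _ norm])
    show "\<bar>p X\<bar> \<le> 1" for X
      using p[of X] by (auto split: if_splits)
    show "u X * v X = 0" if "X \<subseteq> {..<n}" for X using supp that by auto
  qed
  finally show ?thesis by simp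
qed

theorem theorem1p6:
  shows "\<exists>c C :: real. c > 0 \<and> C > 0 \<and>
    (\<forall>n \<ge> 1. \<forall>\<phi>. read_once n \<phi> \<longrightarrow>
       c * sqrt (real n) \<le> real (approx_deg n (\<lambda>x. evalf x \<phi>)) \<and>
       real (approx_deg n (\<lambda>x. evalf x \<phi>)) \<le> C * sqrt (real n))"
proof (rule exI[of _ "1 / 12"], rule exI[of _ 38], intro conjI allI impI)
  fix n :: nat and \<phi>
  assume "read_once n \<phi>"
  then have F: "read_once_fun {..<n} (\<lambda>x. evalf x \<phi>)"
    using read_once_fun_evalf[of \<phi>] by (simp add: read_once_def lessThan_atLeast0)
  let ?P = "\<lambda>d. \<exists>q. poly_deg_le n d q \<and> approximates q (\<lambda>x. evalf x \<phi>)"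
  obtain d where d: "real d \<le> 38 * sqrt n" "?P d" using read_once_fun_approx_upper[OF F] by blast
  have "approx_deg n (\<lambda>x. evalf x \<phi>) \<le> d" unfolding approx_deg_def using d(2) by (rule Least_le)
  then show "real (approx_deg n (\<lambda>x. evalf x \<phi>)) \<le> 38 * sqrt (real n)" using d(1) by linarith
  \<comment> \<open>The upper bound also supplies a witness that the least degree is attained, so
    the lower bound can be applied to it.\<close>
  have "?P (approx_deg n (\<lambda>x. evalf x \<phi>))" unfolding approx_deg_def using d(2) by (rule LeastI)
  then show "1 / 12 * sqrt (real n) \<le> real (approx_deg n (\<lambda>x. evalf x \<phi>))"
    using read_once_fun_approx_lower[OF F] by fastforce
qed simp_all

end
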